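(* Let $p,q$ be positive integers and let $\mathcal{M},\mathcal{N}$ be two matroids on the same finite ground set $V$. Then \[\eta(\mathcal{M}\cap\mathcal{N})\ge \frac{\nu_{p,q}(\mathcal{M},\mathcal{N})}{p+q}.\]
   Context: A matroid on $V$ is a nonempty family of subsets of $V$ (independent sets) closed under subsets and satisfying the augmentation axiom; $\mathcal{M}\cap\mathcal{N}$ is the simplicial complex of sets independent in both. For sets $A_1,\ldots,A_k$ and an element $v$, $\#v(A_1,\ldots,A_k)$ is the number of indices $i$ with $v\in A_i$, and \[\nu_{p,q}(\mathcal{M},\mathcal{N})=\max_{A_1,\ldots,A_p\in\mathcal{M},\ B_1,\ldots,B_q\in\mathcal{N}}\ \sum_{v\in V}\min\big(\#v(A_1,\ldots,A_p),\#v(B_1,\ldots,B_q)\big).\] For a simplicial complex $\mathcal{C}$ and a fixed coefficient ring $R$, the homological connectivity $\eta(\mathcal{C})$ is the minimal $k$ such that the reduced homology $\tilde H_{k-1}(\mathcal{C};R)$ is nonzero; $\eta(\mathcal{C})=0$ if $\mathcal{C}$ is the empty complex, and $\eta(\mathcal{C})=\infty$ if all reduced homology groups vanish. *)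

theory Defs
  imports Complex_Main "HOL-Library.FuncSet" "HOL-Library.Extended_Real" "HOL-Algebra.Coset"
begin

section \<open>Matroids\<close>

text \<open>Meant for finite \<open>V\<close>, where \<open>card\<close> is the true cardinality.\<close>

definition matroid :: "'v set \<Rightarrow> 'v set set \<Rightarrow> bool" where
  "matroid V \<I> \<longleftrightarrow>
     \<I> \<subseteq> Pow V \<and> \<I> \<noteq> {} \<and>
     (\<forall>A\<in>\<I>. \<forall>B. B \<subseteq> A \<longrightarrow> B \<in> \<I>) \<and>
     (\<forall>A\<in>\<I>. \<forall>B\<in>\<I>. card A < card B \<longrightarrow> (\<exists>x\<in>B - A. insert x A \<in> \<I>))"

definition occ :: "'v \<Rightarrow> nat \<Rightarrow> (nat \<Rightarrow> 'v set) \<Rightarrow> nat" where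
  "occ v k A = card {i \<in> {1..k}. v \<in> A i}"

definition nu :: "nat \<Rightarrow> nat \<Rightarrow> 'v set \<Rightarrow> 'v set set \<Rightarrow> 'v set set \<Rightarrow> nat" where
  "nu p q V \<M> \<N> =
     Max ((\<lambda>(A, B). \<Sum>v\<in>V. min (occ v p A) (occ v q B)) `
            (({1..p} \<rightarrow>\<^sub>E \<M>) \<times> ({1..q} \<rightarrow>\<^sub>E \<N>)))"


section \<open>Reduced simplicial homology\<close>

text \<open>
  Oriented simplicial chains. The list \<open>[v0, ..., vd]\<close> of distinct vertices stands for the
  oriented \<open>d\<close>-simplex, and a chain is a finitely supported function on oriented simplices that
  changes sign when the orientation is reversed (adjacent transpositions generate all
  permutations). The empty list is the simplex of dimension \<open>-1\<close>, so that the complex is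
  the augmented one. Degrees are integers.
\<close>

definition simplicial_chains :: "'v set set \<Rightarrow> int \<Rightarrow> ('v list \<Rightarrow> 'r::ring_1) set" where
  "simplicial_chains C d =
     {c. finite {xs. c xs \<noteq> 0} \<and>
         (\<forall>xs. c xs \<noteq> 0 \<longrightarrow> distinct xs \<and> set xs \<in> C \<and> int (length xs) = d + 1) \<and>
         (\<forall>xs u v ys. c (xs @ u # v # ys) = - c (xs @ v # u # ys))}"

text \<open>
  This is the usual operator \<open>[v0, ..., vd] \<mapsto> \<Sum>i. (-1)^i [v0, .., vi omitted, .., vd]\<close>, read off
  coefficientwise: every oriented simplex with \<open>xs\<close> as a facet can be written as \<open>v # xs\<close> up to
  sign, and \<open>xs\<close> occurs in the boundary of \<open>v # xs\<close> with coefficient \<open>1\<close>.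
\<close>

definition simplicial_boundary :: "('v list \<Rightarrow> 'r::ring_1) \<Rightarrow> 'v list \<Rightarrow> 'r" where
  "simplicial_boundary c xs = (\<Sum>v | c (v # xs) \<noteq> 0. c (v # xs))"

definition simplicial_cycles :: "'v set set \<Rightarrow> int \<Rightarrow> ('v list \<Rightarrow> 'r::ring_1) set" where
  "simplicial_cycles C d = {c \<in> simplicial_chains C d. simplicial_boundary c = (\<lambda>_. 0)}"

definition simplicial_boundaries :: "'v set set \<Rightarrow> int \<Rightarrow> ('v list \<Rightarrow> 'r::ring_1) set" where
  "simplicial_boundaries C d = simplicial_boundary ` simplicial_chains C (d + 1)"

definition cycle_group :: "'v set set \<Rightarrow> int \<Rightarrow> ('v list \<Rightarrow> 'r::ring_1) monoid" where
  "cycle_group C d =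
     \<lparr>carrier = simplicial_cycles C d, monoid.mult = (\<lambda>a b xs. a xs + b xs), one = (\<lambda>_. 0)\<rparr>"

definition reduced_homology :: "'v set set \<Rightarrow> int \<Rightarrow> ('v list \<Rightarrow> 'r::ring_1) set monoid" where
  "reduced_homology C d = cycle_group C d Mod simplicial_boundaries C d"

text \<open>
  The coefficient ring is the type \<open>'r\<close>, passed as a type argument. On \<open>enat\<close> the infimum of the
  empty set is \<open>\<infinity>\<close>. Both the complex \<open>{}\<close> without simplices and the complex \<open>{{}}\<close> without
  vertices count as empty; for the latter the value \<open>0\<close> agrees with the general clause.
\<close>

definition eta :: "'r::ring_1 itself \<Rightarrow> 'v set set \<Rightarrow> enat" where
  "eta R C =
     (if C \<subseteq> {{}} then 0
      else Inf {enat k | k.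
             carrier (reduced_homology C (int k - 1) :: ('v list \<Rightarrow> 'r) set monoid)
               \<noteq> {one (reduced_homology C (int k - 1))}})"

end

(*
  Write C for the complex of common independent sets. The starting point is the vector
  x_v = min(#v(A), #v(B)), which satisfies x(S) <= p r_M(S) and x(S) <= q r_N(S) for every S;
  any such real vector x >= 0 forces the reduced homology of C to vanish in all degrees d with
  (d + 1)(p + q) < x(V). For the induction the matroids M and N are allowed to live on different
  ground sets E and F, and C consists of the A with A \<inter> E in M and A \<inter> F in N.
  If E and F are disjoint, C is a matroid, whose homology vanishes below its rank.
  Otherwise replace x by an extreme point without decreasing its total. A count of the tight
  constraints yields v in E \<inter> F with x_v = 0, x_v = p or x_v = q.
  If x_v = 0, deleting v from both matroids costs nothing and contracting it in both costs at most
  p + q, so the exact sequence relating C, C - v and the link of v applies.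
  If x_v = p, use that the reduced homology of C is that of the pair (C - v, link of v), and put
  between link and deletion the complex K belonging to M/v and N - v. The pairs (K, link) and
  (C - v, K) belong to the matroid pairs (M/v, N) and (M, N - v), in which v remains an element
  of only one ground set, and x is admissible for both. The case x_v = q is symmetric.
*)
theory Submission imports Defs "HOL-Library.Indicator_Function" begin

section \<open>Vanishing of homology\<close>

text \<open>The constant p + q is the price of one degree: contracting v lowers each rank by at most
  one, so x has to give up at most p in total for M and at most q for N, while the degree drops by
  one. The obstacle is a v with x_v > 0, as deleting it from both matroids loses x_v at the same
  degree. If x_v = p, contracting v in M alone loses nothing: p + x(S) \<le> p r_M(S + v) \<le> p
  r_{M/v}(S) + p for S avoiding v, and v still counts in the total because it stays in the ground
  set of N. Hence the ground sets must be allowed to drift apart. An extreme point can also have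
  coordinates such as p - q, so only one good element of E \<inter> F is claimed. The count looks
  for a leaf: elements of E \<inter> F are edges between classes, a class consisting of support
  elements that the tight sets of M (or of N) do not separate. A class {v} of M makes x_v a positive
  difference of two multiples of p that is at most p, hence p; likewise q for N.\<close>

definition acyclic_at :: "'r::ring_1 itself \<Rightarrow> 'v set set \<Rightarrow> int \<Rightarrow> bool" where
  "acyclic_at R C d \<longleftrightarrow>
     (simplicial_cycles C d :: ('v list \<Rightarrow> 'r) set) \<subseteq> simplicial_boundaries C d"

text \<open>Vanishing of H_d(D, L), spelled out on chains of \<open>D\<close> instead of a quotient
  complex: a relative cycle has its boundary in \<open>L\<close>, and it must be a boundary up to a
  chain of \<open>L\<close>.\<close>

definition rel_acyclic_at :: "'r::ring_1 itself \<Rightarrow> 'v set set \<Rightarrow> 'v set set \<Rightarrow> int \<Rightarrow> bool" where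
  "rel_acyclic_at R D L d \<longleftrightarrow>
     (\<forall>a \<in> (simplicial_chains D d :: ('v list \<Rightarrow> 'r) set).
        simplicial_boundary a \<in> simplicial_chains L (d - 1) \<longrightarrow>
        (\<exists>b \<in> simplicial_chains D (d + 1).
           (\<lambda>xs. a xs - simplicial_boundary b xs) \<in> simplicial_chains L d))"

definition down_closed :: "'v set set \<Rightarrow> bool" where
  "down_closed C \<longleftrightarrow> (\<forall>A\<in>C. \<forall>B. B \<subseteq> A \<longrightarrow> B \<in> C)"

section \<open>Oriented chains over a finite vertex set and their boundary\<close>

lemma simplicial_chains_iff:
  assumes "finite V" "C \<subseteq> Pow V"
  shows "c \<in> simplicial_chains C d \<longleftrightarrow>
     (\<forall>xs. c xs \<noteq> 0 \<longrightarrow> distinct xs \<and> set xs \<in> C \<and> int (length xs) = d + 1) \<and>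
     (\<forall>xs u v ys. c (xs @ u # v # ys) = - c (xs @ v # u # ys))"
proof -
  have "finite {xs. c xs \<noteq> 0}"
    if "\<forall>xs. c xs \<noteq> 0 \<longrightarrow> distinct xs \<and> set xs \<in> C \<and> int (length xs) = d + 1"
  proof (rule finite_subset)
    show "{xs. c xs \<noteq> 0} \<subseteq> {xs. set xs \<subseteq> V \<and> distinct xs}"
      using that assms(2) by auto
    show "finite {xs. set xs \<subseteq> V \<and> distinct xs}"
      by (rule finite_subset_distinct[OF assms(1)])
  qed
  then show ?thesis
    unfolding simplicial_chains_def mem_Collect_eq by iprover
qed

lemma simplicial_chains_expand:
  "c \<in> simplicial_chains C d \<longleftrightarrow> finite {xs. c xs \<noteq> 0} \<and>
     (\<forall>xs. c xs \<noteq> 0 \<longrightarrow> distinct xs \<and> set xs \<in> C \<and> int (length xs) = d + 1) \<and>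
     (\<forall>xs u v ys. c (xs @ u # v # ys) = - c (xs @ v # u # ys))"
  unfolding simplicial_chains_def by (rule mem_Collect_eq)

lemma simplicial_chainsD:
  assumes "c \<in> simplicial_chains C d"
  shows "c xs \<noteq> 0 \<Longrightarrow> distinct xs"
    and "c xs \<noteq> 0 \<Longrightarrow> set xs \<in> C"
    and "c xs \<noteq> 0 \<Longrightarrow> int (length xs) = d + 1"
    and "c (xs @ u # v # ys) = - c (xs @ v # u # ys)"
    and "c (u # v # ys) = - c (v # u # ys)"
proof -
  note c = assms[unfolded simplicial_chains_expand, THEN conjunct2]
  show "c xs \<noteq> 0 \<Longrightarrow> distinct xs" "c xs \<noteq> 0 \<Longrightarrow> set xs \<in> C"
    "c xs \<noteq> 0 \<Longrightarrow> int (length xs) = d + 1"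
    using spec[OF conjunct1[OF c], of xs] by iprover+
  show swap: "c (xs @ u # v # ys) = - c (xs @ v # u # ys)" for xs u v ys
    by (rule conjunct2[OF c, rule_format])
  show "c (u # v # ys) = - c (v # u # ys)"
    by (rule swap[of "[]", unfolded append_Nil])
qed

lemma simplicial_chains_mono:
  assumes "C \<subseteq> C'"
  shows "simplicial_chains C d \<subseteq> simplicial_chains C' d"
proof
  fix c :: "'a list \<Rightarrow> 'b" assume "c \<in> simplicial_chains C d"
  then show "c \<in> simplicial_chains C' d"
    using subsetD[OF assms] unfolding simplicial_chains_expand by iprover
qed

lemma simplicial_chains_zero: "(\<lambda>_. 0) \<in> simplicial_chains C d"
  unfolding simplicial_chains_expand by simp

lemma simplicial_chains_diff:
  assumes "a \<in> simplicial_chains C d" "b \<in> simplicial_chains C d"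
  shows "(\<lambda>xs. a xs - b xs) \<in> simplicial_chains C d"
  unfolding simplicial_chains_expand
proof (intro conjI allI impI)
  have "finite {xs. a xs \<noteq> 0}" "finite {xs. b xs \<noteq> 0}"
    using assms unfolding simplicial_chains_expand by iprover+
  then show "finite {xs. a xs - b xs \<noteq> 0}"
    by (rule finite_subset[where B = "{xs. a xs \<noteq> 0} \<union> {xs. b xs \<noteq> 0}", rotated, OF finite_UnI]) auto
next
  fix xs assume "a xs - b xs \<noteq> 0"
  then have "a xs \<noteq> 0 \<or> b xs \<noteq> 0" by auto
  then show "distinct xs" "set xs \<in> C" "int (length xs) = d + 1"
    using simplicial_chainsD(1-3)[OF assms(1)] simplicial_chainsD(1-3)[OF assms(2)] by iprover+
next
  fix xs u v ys
  show "a (xs @ u # v # ys) - b (xs @ u # v # ys) = - (a (xs @ v # u # ys) - b (xs @ v # u # ys))"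
    unfolding simplicial_chainsD(4)[OF assms(1), of xs u v ys]
      simplicial_chainsD(4)[OF assms(2), of xs u v ys] by simp
qed

lemma simplicial_chains_uminus:
  "a \<in> simplicial_chains C d \<Longrightarrow> (\<lambda>xs. - a xs) \<in> simplicial_chains C d"
  using simplicial_chains_diff[OF simplicial_chains_zero, of a C d] by simp

lemma simplicial_chains_add:
  assumes "a \<in> simplicial_chains C d" "b \<in> simplicial_chains C d"
  shows "(\<lambda>xs. a xs + b xs) \<in> simplicial_chains C d"
  using simplicial_chains_diff[OF assms(1) simplicial_chains_uminus[OF assms(2)]] by simp

text \<open>The index set in the definition depends on the chain. Adding zero terms turns it into
  the fixed set \<open>V\<close>, which makes linearity and exchange of sums available.\<close>

lemma simplicial_boundary_eq_sum:
  assumes "finite V" "C \<subseteq> Pow V" "c \<in> simplicial_chains C d"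
  shows "simplicial_boundary c xs = (\<Sum>u\<in>V. c (u # xs))"
  unfolding simplicial_boundary_def
proof (rule sum.mono_neutral_left)
  show "{v. c (v # xs) \<noteq> 0} \<subseteq> V"
  proof
    fix v assume "v \<in> {v. c (v # xs) \<noteq> 0}"
    then have "set (v # xs) \<in> C" using simplicial_chainsD(2)[OF assms(3), of "v # xs"] by blast
    then show "v \<in> V" using assms(2) by auto
  qed
qed (use assms(1) in auto)

lemma simplicial_boundary_nonzeroE:
  assumes "simplicial_boundary c xs \<noteq> 0"
  obtains u where "c (u # xs) \<noteq> 0"
  using assms unfolding simplicial_boundary_def by (rule sum.not_neutral_contains_not_neutral) (rule that)

lemma simplicial_boundary_diff:
  assumes "a \<in> simplicial_chains C d" "b \<in> simplicial_chains C d" "finite V" "C \<subseteq> Pow V"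
  shows "simplicial_boundary (\<lambda>xs. a xs - b xs) = (\<lambda>xs. simplicial_boundary a xs - simplicial_boundary b xs)"
  using simplicial_boundary_eq_sum[OF assms(3,4) assms(1)] simplicial_boundary_eq_sum[OF assms(3,4) assms(2)]
    simplicial_boundary_eq_sum[OF assms(3,4) simplicial_chains_diff[OF assms(1,2)]]
  by (intro ext) (simp only: sum_subtractf)

lemma simplicial_boundary_zero: "simplicial_boundary (\<lambda>_. 0) = (\<lambda>_. 0)"
  unfolding simplicial_boundary_def by simp

lemma simplicial_boundary_in_chains:
  assumes "c \<in> simplicial_chains C d" "finite V" "C \<subseteq> Pow V" "down_closed C"
  shows "simplicial_boundary c \<in> simplicial_chains C (d - 1)"
  unfolding simplicial_chains_iff[OF assms(2,3)]
proof (intro conjI allI impI)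
  fix xs assume "simplicial_boundary c xs \<noteq> 0"
  then obtain u where "c (u # xs) \<noteq> 0" by (rule simplicial_boundary_nonzeroE)
  note u = simplicial_chainsD(1-3)[OF assms(1) this]
  have "set xs \<subseteq> set (u # xs)" by auto
  with u(2) assms(4) show "set xs \<in> C" unfolding down_closed_def by blast
  from u show "distinct xs" "int (length xs) = d - 1 + 1" by simp_all
next
  fix xs u v ys
  have "c (w # xs @ u # v # ys) = - c (w # xs @ v # u # ys)" for w
    by (rule simplicial_chainsD(4)[OF assms(1), of "w # xs", unfolded append_Cons])
  then show "simplicial_boundary c (xs @ u # v # ys) = - simplicial_boundary c (xs @ v # u # ys)"
    unfolding simplicial_boundary_eq_sum[OF assms(2,3,1)] sum_negf[symmetric]
    by (rule sum.cong[OF refl])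
qed

text \<open>The diagonal hypothesis is what makes this work in characteristic 2.\<close>

lemma sum_antisym_eq_0:
  fixes a :: "'a \<Rightarrow> 'a \<Rightarrow> 'r::ab_group_add"
  assumes "finite V" "\<And>u v. a u v = - a v u" "\<And>u. a u u = 0"
  shows "(\<Sum>u\<in>V. \<Sum>v\<in>V. a u v) = 0"
  using assms(1)
proof induction
  case (insert z V)
  have "(\<Sum>u\<in>V. a u z) = - (\<Sum>v\<in>V. a z v)"
    unfolding sum_negf[symmetric] by (rule sum.cong[OF refl assms(2)])
  with insert show ?case
    by (simp add: sum.distrib assms(3))
qed simp

lemma simplicial_boundary_boundary:
  assumes "c \<in> simplicial_chains C d" "finite V" "C \<subseteq> Pow V" "down_closed C"
  shows "simplicial_boundary (simplicial_boundary c) = (\<lambda>_. 0)"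
proof
  fix xs
  have "simplicial_boundary (simplicial_boundary c) xs = (\<Sum>u\<in>V. \<Sum>v\<in>V. c (v # u # xs))"
    unfolding simplicial_boundary_eq_sum[OF assms(2,3) simplicial_boundary_in_chains[OF assms]]
    unfolding simplicial_boundary_eq_sum[OF assms(2,3,1)] ..
  also have "\<dots> = 0"
  proof (rule sum_antisym_eq_0[OF assms(2)])
    show "c (v # u # xs) = - c (u # v # xs)" for u v
      by (rule simplicial_chainsD(5)[OF assms(1)])
    \<comment> \<open>Antisymmetry alone would only give 2c = 0; the value vanishes because a chain
      is zero on lists with a repeated vertex.\<close>
    show "c (u # u # xs) = 0" for u
      using simplicial_chainsD(1)[OF assms(1), of "u # u # xs"] by auto
  qed
  finally show "simplicial_boundary (simplicial_boundary c) xs = 0" .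
qed

section \<open>Adding a vertex to a complex\<close>

definition add_cone :: "'v \<Rightarrow> 'v set set \<Rightarrow> 'v set set \<Rightarrow> 'v set set" where
  "add_cone v D L = D \<union> insert v ` L"

text \<open>The cone v * l over a chain l that avoids v. The sign moves the first occurrence of
  \<open>v\<close> to the front, where the value is that of \<open>l\<close>; the alternating rule
  leaves no other choice. With \<partial> for the boundary, \<partial>(v * l) = l - v *
  \<partial>l.\<close>

definition cone_chain :: "'v \<Rightarrow> ('v list \<Rightarrow> 'r::ring_1) \<Rightarrow> 'v list \<Rightarrow> 'r" where
  "cone_chain v l xs =
     (if v \<in> set xs then (- 1) ^ length (takeWhile (\<lambda>u. u \<noteq> v) xs) * l (remove1 v xs) else 0)"

lemma cone_chain_Cons: "cone_chain v l (v # xs) = l xs"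
  unfolding cone_chain_def by simp

lemma cone_chain_swap:
  assumes "l \<in> simplicial_chains L d" "\<forall>A\<in>L. v \<notin> A"
  shows "cone_chain v l (xs @ a # b # ys) = - cone_chain v l (xs @ b # a # ys)"
proof -
  have l0: "l zs = 0" if "v \<in> set zs" for zs
    using simplicial_chainsD(2)[OF assms(1), of zs] assms(2) that by blast
  show ?thesis
  proof (cases "v \<in> set xs")
    case True
    have "takeWhile (\<lambda>u. u \<noteq> v) (xs @ zs) = takeWhile (\<lambda>u. u \<noteq> v) xs" for zs
      using True by (simp add: takeWhile_append1)
    then show ?thesis
      using True simplicial_chainsD(4)[OF assms(1), of "remove1 v xs" a b ys]
      by (simp add: cone_chain_def remove1_append)
  next
    case False
    then have tw: "takeWhile (\<lambda>u. u \<noteq> v) (xs @ zs) = xs @ takeWhile (\<lambda>u. u \<noteq> v) zs" for zs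
      by (metis (mono_tags, lifting) takeWhile_append2)
    show ?thesis
    proof (cases "a = v \<or> b = v")
      case True
      \<comment> \<open>If only one of \<open>a\<close>, \<open>b\<close> is \<open>v\<close>, its
        position changes by one and the sign flips. If both are \<open>v\<close>, one copy survives
        \<open>remove1\<close> and both sides vanish by \<open>l0\<close>.\<close>
      then show ?thesis
        using False tw l0[of "xs @ v # ys"] by (auto simp: cone_chain_def remove1_append)
    next
      case ab: False
      have eq: "cone_chain v l (xs @ a' # b' # ys) =
          (if v \<in> set ys then (- 1) ^ (length xs + 2 + length (takeWhile (\<lambda>u. u \<noteq> v) ys)) *
             l (xs @ a' # b' # remove1 v ys) else 0)" if "a' \<noteq> v" "b' \<noteq> v" for a' b'
        using False that tw[of "a' # b' # ys"] by (simp add: cone_chain_def remove1_append)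
      have "a \<noteq> v" "b \<noteq> v" using ab by auto
      then show ?thesis
        unfolding eq[OF \<open>a \<noteq> v\<close> \<open>b \<noteq> v\<close>] eq[OF \<open>b \<noteq> v\<close> \<open>a \<noteq> v\<close>]
        by (subst simplicial_chainsD(4)[OF assms(1), of xs a b]) simp
    qed
  qed
qed

lemma cone_chain_Cons_Cons:
  assumes "l \<in> simplicial_chains L d" "\<forall>A\<in>L. v \<notin> A"
  shows "cone_chain v l (u # v # ys) = - l (u # ys)"
  using cone_chain_swap[OF assms, of "[]" u v ys] by (simp add: cone_chain_Cons)

lemma cone_chain_in_chains:
  assumes "l \<in> simplicial_chains L d" "\<forall>A\<in>L. v \<notin> A" "finite V" "add_cone v D L \<subseteq> Pow V"
  shows "cone_chain v l \<in> simplicial_chains (add_cone v D L) (d + 1)"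
  unfolding simplicial_chains_iff[OF assms(3,4)]
proof (intro conjI allI impI)
  fix xs assume nz: "cone_chain v l xs \<noteq> 0"
  then have v: "v \<in> set xs" and "l (remove1 v xs) \<noteq> 0"
    by (auto simp: cone_chain_def split: if_splits)
  from simplicial_chainsD(1-3)[OF assms(1) this(2)]
  have *: "distinct (remove1 v xs)" "set (remove1 v xs) \<in> L" "int (length (remove1 v xs)) = d + 1" by auto
  obtain as bs where xs: "xs = as @ v # bs" "v \<notin> set as"
    using v by (meson split_list_first)
  then have "remove1 v xs = as @ bs" by (simp add: remove1_append)
  with * xs assms(2) show "distinct xs" "set xs \<in> add_cone v D L" "int (length xs) = d + 1 + 1"
    by (auto simp: add_cone_def image_iff)
qed (rule cone_chain_swap[OF assms(1,2)])

lemma alternating_move_front: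
  fixes f :: "'v list \<Rightarrow> 'r::ring_1"
  assumes "\<And>xs u v ys. f (xs @ u # v # ys) = - f (xs @ v # u # ys)"
  shows "f (as @ v # bs) = (- 1) ^ length as * f (v # as @ bs)"
proof (induction as arbitrary: bs rule: rev_induct)
  case (snoc a as)
  have "f ((as @ [a]) @ v # bs) = - f (as @ v # a # bs)"
    using assms[of as a v bs] by simp
  then show ?case using snoc[of "a # bs"] by simp
qed simp

text \<open>Up to sign, a list containing \<open>v\<close> can be replaced by one that starts with
  \<open>v\<close>. In this way equality of chains is checked separately on the part avoiding
  \<open>v\<close> and on the coefficient of \<open>v\<close>.\<close>

lemma chains_eqI:
  assumes "f \<in> simplicial_chains C d" "g \<in> simplicial_chains C' d'"
    and "\<And>xs. v \<notin> set xs \<Longrightarrow> f xs = g xs" and "\<And>xs. f (v # xs) = g (v # xs)"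
  shows "f = g"
proof
  fix xs show "f xs = g xs"
  proof (cases "v \<in> set xs")
    case True
    then obtain as bs where "xs = as @ v # bs" by (meson split_list)
    then show ?thesis
      using alternating_move_front[of f as v bs, OF simplicial_chainsD(4)[OF assms(1)]]
        alternating_move_front[of g as v bs, OF simplicial_chainsD(4)[OF assms(2)]] assms(4) by simp
  qed (rule assms(3))
qed

text \<open>This is the chain l in the splitting z = a + v * l. Faces through \<open>v\<close> come
  from the cone over \<open>L\<close> only, since \<open>D\<close> avoids \<open>v\<close>; the
  chain a is treated in the next lemma.\<close>

lemma link_chain_in_chains:
  assumes "z \<in> simplicial_chains (add_cone v D L) d" "\<forall>A\<in>D. v \<notin> A" "\<forall>A\<in>L. v \<notin> A"
    "finite V" "L \<subseteq> Pow V"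
  shows "(\<lambda>xs. z (v # xs)) \<in> simplicial_chains L (d - 1)"
  unfolding simplicial_chains_iff[OF assms(4,5)]
proof (intro conjI allI impI)
  fix xs assume "z (v # xs) \<noteq> 0"
  from simplicial_chainsD(1-3)[OF assms(1) this]
  have *: "distinct (v # xs)" "insert v (set xs) \<in> add_cone v D L" "int (length (v # xs)) = d + 1" by auto
  then obtain A where "A \<in> L" "insert v (set xs) = insert v A"
    using assms(2) by (auto simp: add_cone_def)
  moreover from this have "set xs = A" using *(1) assms(3) by auto
  ultimately show "distinct xs" "set xs \<in> L" "int (length xs) = d - 1 + 1" using * by auto
next
  show "z (v # xs @ a # b # ys) = - z (v # xs @ b # a # ys)" for xs a b ys
    by (rule simplicial_chainsD(4)[OF assms(1), of "v # xs", unfolded append_Cons])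
qed

lemma deletion_chain_in_chains:
  assumes "z \<in> simplicial_chains (add_cone v D L) d" "finite V" "D \<subseteq> Pow V"
  shows "(\<lambda>xs. if v \<in> set xs then 0 else z xs) \<in> simplicial_chains D d"
  unfolding simplicial_chains_iff[OF assms(2,3)]
proof (intro conjI allI impI)
  fix xs assume "(if v \<in> set xs then 0 else z xs) \<noteq> 0"
  then have *: "z xs \<noteq> 0" "v \<notin> set xs" by (auto split: if_splits)
  from simplicial_chainsD(1-3)[OF assms(1) *(1)] *(2)
  show "distinct xs" "set xs \<in> D" "int (length xs) = d + 1" by (auto simp: add_cone_def)
next
  show "(if v \<in> set (xs @ a # b # ys) then 0 else z (xs @ a # b # ys)) =
        - (if v \<in> set (xs @ b # a # ys) then 0 else z (xs @ b # a # ys))" for xs a b ys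
    using simplicial_chainsD(4)[OF assms(1), of xs a b ys] by auto
qed

text \<open>\<open>add_cone v D L\<close> is the union of \<open>D\<close> and a cone over \<open>L\<close>, so its reduced homology is that
  of the pair \<open>(D, L)\<close>.\<close>

locale vertex_addition =
  fixes V :: "'v set" and v :: 'v and D L :: "'v set set"
  assumes finite_V: "finite V" and v_in: "v \<in> V" and D_sub: "D \<subseteq> Pow V" and L_sub: "L \<subseteq> D"
    and D_down: "down_closed D" and L_down: "down_closed L" and v_notin: "\<forall>A\<in>D. v \<notin> A"
begin

lemma L_Pow: "L \<subseteq> Pow V" and v_notin_L: "\<forall>A\<in>L. v \<notin> A"
  using D_sub L_sub v_notin by auto

lemma add_cone_Pow: "add_cone v D L \<subseteq> Pow V"
  using v_in D_sub L_Pow by (auto simp: add_cone_def)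

lemma add_cone_down: "down_closed (add_cone v D L)"
proof -
  have "B \<in> add_cone v D L" if "A \<in> L" "B \<subseteq> insert v A" for A B
  proof (cases "v \<in> B")
    case True
    have "B - {v} \<in> L" using that L_down unfolding down_closed_def by blast
    then have "insert v (B - {v}) \<in> insert v ` L" by (rule imageI)
    then show ?thesis using True by (simp add: add_cone_def insert_absorb)
  next
    case False
    then have "B \<subseteq> A" using that(2) by auto
    then show ?thesis using that L_down L_sub unfolding down_closed_def add_cone_def by blast
  qed
  moreover have "B \<in> add_cone v D L" if "A \<in> D" "B \<subseteq> A" for A B
    using that D_down unfolding down_closed_def add_cone_def by blast
  ultimately show ?thesis
    unfolding down_closed_def by (auto simp: add_cone_def)
qed

text \<open>Write z = a + v * l. That z is a cycle gives \<partial>a = -l, so a is a relative cycle.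
  If m = a - \<partial>b lies in \<open>L\<close>, then \<partial>m = -l, and z is the boundary of b
  + v * m.\<close>

lemma acyclic_at_add_coneI:
  assumes rel: "rel_acyclic_at TYPE('r::ring_1) D L d"
  shows "acyclic_at TYPE('r) (add_cone v D L) d"
  unfolding acyclic_at_def
proof
  let ?C = "add_cone v D L"
  fix z :: "'v list \<Rightarrow> 'r" assume "z \<in> simplicial_cycles ?C d"
  then have zC: "z \<in> simplicial_chains ?C d" and z0: "simplicial_boundary z = (\<lambda>_. 0)"
    by (auto simp: simplicial_cycles_def)
  define l where "l = (\<lambda>xs. z (v # xs))"
  define a where "a = (\<lambda>xs. if v \<in> set xs then 0 else z xs)"
  have l: "l \<in> simplicial_chains L (d - 1)"
    unfolding l_def by (rule link_chain_in_chains[OF zC v_notin v_notin_L finite_V L_Pow])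
  have a: "a \<in> simplicial_chains D d"
    unfolding a_def by (rule deletion_chain_in_chains[OF zC finite_V D_sub])
  have ba: "simplicial_boundary a = (\<lambda>xs. - l xs)"
  proof
    fix xs
    show "simplicial_boundary a xs = - l xs"
    proof (cases "v \<in> set xs")
      case True
      moreover from True have "l xs = 0" using simplicial_chainsD(2)[OF l, of xs] v_notin_L by blast
      ultimately show ?thesis by (simp add: simplicial_boundary_def a_def)
    next
      case False
      have "0 = (\<Sum>u\<in>V. z (u # xs))"
        using fun_cong[OF z0, of xs] simplicial_boundary_eq_sum[OF finite_V add_cone_Pow zC, of xs] by simp
      also have "\<dots> = l xs + (\<Sum>u\<in>V - {v}. z (u # xs))"
        unfolding l_def by (rule sum.remove[OF finite_V v_in])
      also have "(\<Sum>u\<in>V - {v}. z (u # xs)) = (\<Sum>u\<in>V - {v}. a (u # xs))"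
        by (rule sum.cong) (use False in \<open>auto simp: a_def\<close>)
      also have "\<dots> = (\<Sum>u\<in>V. a (u # xs))"
        by (rule sum.mono_neutral_left) (use finite_V in \<open>auto simp: a_def\<close>)
      also have "\<dots> = simplicial_boundary a xs"
        using simplicial_boundary_eq_sum[OF finite_V D_sub a, of xs] by simp
      finally show ?thesis by (simp add: eq_neg_iff_add_eq_0 add.commute)
    qed
  qed
  have "simplicial_boundary a \<in> simplicial_chains L (d - 1)"
    unfolding ba by (rule simplicial_chains_uminus[OF l])
  with rel a obtain b where b: "b \<in> simplicial_chains D (d + 1)"
    and m: "(\<lambda>xs. a xs - simplicial_boundary b xs) \<in> simplicial_chains L d"
    unfolding rel_acyclic_at_def by blast
  define m where "m = (\<lambda>xs. a xs - simplicial_boundary b xs)"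
  have m: "m \<in> simplicial_chains L d" using m unfolding m_def .
  have bb: "simplicial_boundary b \<in> simplicial_chains D d"
    using simplicial_boundary_in_chains[OF b finite_V D_sub D_down] by simp
  have bm: "simplicial_boundary m = (\<lambda>xs. - l xs)"
    unfolding m_def simplicial_boundary_diff[OF a bb finite_V D_sub]
      simplicial_boundary_boundary[OF b finite_V D_sub D_down] by (simp add: ba)
  have cm: "cone_chain v m \<in> simplicial_chains ?C (d + 1)"
    by (rule cone_chain_in_chains[OF m v_notin_L finite_V add_cone_Pow])
  have bC: "b \<in> simplicial_chains ?C (d + 1)"
    using b simplicial_chains_mono[of D ?C "d + 1"] by (auto simp: add_cone_def)
  define u where "u = (\<lambda>xs. b xs + cone_chain v m xs)"
  have u: "u \<in> simplicial_chains ?C (d + 1)"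
    unfolding u_def by (rule simplicial_chains_add[OF bC cm])
  have sumu: "simplicial_boundary u xs = simplicial_boundary b xs + (\<Sum>w\<in>V. cone_chain v m (w # xs))" for xs
    unfolding simplicial_boundary_eq_sum[OF finite_V add_cone_Pow u]
      simplicial_boundary_eq_sum[OF finite_V D_sub b] by (simp add: u_def sum.distrib)
  have "simplicial_boundary u = z"
  proof (rule chains_eqI[where v = v])
    show "simplicial_boundary u \<in> simplicial_chains ?C (d + 1 - 1)"
      by (rule simplicial_boundary_in_chains[OF u finite_V add_cone_Pow add_cone_down])
    show "z \<in> simplicial_chains ?C d" by (rule zC)
  next
    fix xs assume xs: "v \<notin> set xs"
    have "(\<Sum>w\<in>V. cone_chain v m (w # xs)) = (\<Sum>w\<in>{v}. cone_chain v m (w # xs))"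
      by (rule sum.mono_neutral_right) (use finite_V v_in xs in \<open>auto simp: cone_chain_def\<close>)
    then show "simplicial_boundary u xs = z xs"
      unfolding sumu using xs by (simp add: cone_chain_Cons m_def a_def)
  next
    fix xs
    have "simplicial_boundary b (v # xs) = 0"
      using simplicial_chainsD(2)[OF bb, of "v # xs"] v_notin by auto
    moreover have "(\<Sum>w\<in>V. cone_chain v m (w # v # xs)) = - simplicial_boundary m xs"
      unfolding simplicial_boundary_eq_sum[OF finite_V L_Pow m]
      by (simp add: cone_chain_Cons_Cons[OF m v_notin_L] sum_negf)
    ultimately show "simplicial_boundary u (v # xs) = z (v # xs)"
      unfolding sumu by (simp add: bm l_def)
  qed
  then show "z \<in> simplicial_boundaries ?C d"
    unfolding simplicial_boundaries_def using u by blast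
qed

text \<open>A relative cycle a closes up to the cycle a - v * \<partial>a. If this equals
  \<partial>w, splitting w at \<open>v\<close> into b + v * k yields a - \<partial>b = k, a chain of
  \<open>L\<close>.\<close>

lemma acyclic_at_add_coneD:
  assumes acyc: "acyclic_at TYPE('r::ring_1) (add_cone v D L) d"
  shows "rel_acyclic_at TYPE('r) D L d"
  unfolding rel_acyclic_at_def
proof (intro ballI impI)
  let ?C = "add_cone v D L"
  fix a :: "'v list \<Rightarrow> 'r"
  assume a: "a \<in> simplicial_chains D d" and l: "simplicial_boundary a \<in> simplicial_chains L (d - 1)"
  define l where "l = simplicial_boundary a"
  have l: "l \<in> simplicial_chains L (d - 1)" using l unfolding l_def .
  have bl: "simplicial_boundary l = (\<lambda>_. 0)"
    unfolding l_def by (rule simplicial_boundary_boundary[OF a finite_V D_sub D_down])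
  define z where "z = (\<lambda>xs. a xs - cone_chain v l xs)"
  have aC: "a \<in> simplicial_chains ?C d"
    using a simplicial_chains_mono[of D ?C d] by (auto simp: add_cone_def)
  have cl: "cone_chain v l \<in> simplicial_chains ?C d"
    using cone_chain_in_chains[OF l v_notin_L finite_V add_cone_Pow] by simp
  have z: "z \<in> simplicial_chains ?C d"
    unfolding z_def by (rule simplicial_chains_diff[OF aC cl])
  have sumz: "simplicial_boundary z xs = l xs - (\<Sum>w\<in>V. cone_chain v l (w # xs))" for xs
    unfolding simplicial_boundary_eq_sum[OF finite_V add_cone_Pow z] fun_cong[OF l_def, of xs]
      simplicial_boundary_eq_sum[OF finite_V D_sub a] by (simp add: z_def sum_subtractf)
  have "simplicial_boundary z = (\<lambda>_. 0)"
  proof (rule chains_eqI[where v = v])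
    show "simplicial_boundary z \<in> simplicial_chains ?C (d - 1)"
      by (rule simplicial_boundary_in_chains[OF z finite_V add_cone_Pow add_cone_down])
    show "(\<lambda>_. 0) \<in> simplicial_chains ?C d" by (rule simplicial_chains_zero)
  next
    fix xs assume xs: "v \<notin> set xs"
    have "(\<Sum>w\<in>V. cone_chain v l (w # xs)) = (\<Sum>w\<in>{v}. cone_chain v l (w # xs))"
      by (rule sum.mono_neutral_right) (use finite_V v_in xs in \<open>auto simp: cone_chain_def\<close>)
    then show "simplicial_boundary z xs = 0"
      unfolding sumz by (simp add: cone_chain_Cons)
  next
    fix xs
    have "l (v # xs) = 0"
      using simplicial_chainsD(2)[OF l, of "v # xs"] v_notin_L by auto
    moreover have "(\<Sum>w\<in>V. cone_chain v l (w # v # xs)) = - simplicial_boundary l xs"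
      unfolding simplicial_boundary_eq_sum[OF finite_V L_Pow l]
      by (simp add: cone_chain_Cons_Cons[OF l v_notin_L] sum_negf)
    ultimately show "simplicial_boundary z (v # xs) = 0"
      unfolding sumz by (simp add: bl)
  qed
  then have "z \<in> simplicial_boundaries ?C d"
    using acyc z unfolding acyclic_at_def simplicial_cycles_def by blast
  then obtain w where w: "w \<in> simplicial_chains ?C (d + 1)" and zw: "z = simplicial_boundary w"
    unfolding simplicial_boundaries_def by blast
  define b where "b = (\<lambda>xs. if v \<in> set xs then 0 else w xs)"
  define k where "k = (\<lambda>xs. w (v # xs))"
  have b: "b \<in> simplicial_chains D (d + 1)"
    unfolding b_def by (rule deletion_chain_in_chains[OF w finite_V D_sub])
  have k: "k \<in> simplicial_chains L d"
    unfolding k_def using link_chain_in_chains[OF w v_notin v_notin_L finite_V L_Pow] by simp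
  have bb: "simplicial_boundary b \<in> simplicial_chains D d"
    using simplicial_boundary_in_chains[OF b finite_V D_sub D_down] by simp
  have "(\<lambda>xs. a xs - simplicial_boundary b xs) = k"
  proof
    fix xs show "a xs - simplicial_boundary b xs = k xs"
    proof (cases "v \<in> set xs")
      case True
      have "a xs = 0" "simplicial_boundary b xs = 0" "k xs = 0"
        using True simplicial_chainsD(2)[OF a, of xs] simplicial_chainsD(2)[OF bb, of xs]
          simplicial_chainsD(2)[OF k, of xs] v_notin v_notin_L by blast+
      then show ?thesis by simp
    next
      case False
      have "a xs = z xs" using False by (simp add: z_def cone_chain_def)
      also have "\<dots> = (\<Sum>u\<in>V. w (u # xs))"
        unfolding zw by (rule simplicial_boundary_eq_sum[OF finite_V add_cone_Pow w])
      also have "\<dots> = k xs + (\<Sum>u\<in>V - {v}. w (u # xs))"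
        unfolding k_def by (rule sum.remove[OF finite_V v_in])
      also have "(\<Sum>u\<in>V - {v}. w (u # xs)) = (\<Sum>u\<in>V - {v}. b (u # xs))"
        by (rule sum.cong) (use False in \<open>auto simp: b_def\<close>)
      also have "\<dots> = (\<Sum>u\<in>V. b (u # xs))"
        by (rule sum.mono_neutral_left) (use finite_V in \<open>auto simp: b_def\<close>)
      also have "\<dots> = simplicial_boundary b xs"
        using simplicial_boundary_eq_sum[OF finite_V D_sub b, of xs] by simp
      finally show ?thesis by simp
    qed
  qed
  then show "\<exists>b\<in>simplicial_chains D (d + 1).
      (\<lambda>xs. a xs - simplicial_boundary b xs) \<in> simplicial_chains L d"
    using k by (intro bexI[OF _ b]) simp
qed

end

section \<open>Fragments of the exact sequences of a pair and of a triple\<close>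

lemma rel_acyclic_at_refl: "rel_acyclic_at R C C d"
  unfolding rel_acyclic_at_def
  by (auto intro!: bexI[OF _ simplicial_chains_zero] simp: simplicial_boundary_zero)

text \<open>Exactness of H_d(D) -> H_d(D, L) -> H_{d-1}(L) in the middle: a chain m of
  \<open>L\<close> with \<partial>m = \<partial>a turns the relative cycle a into the cycle a - m of
  \<open>D\<close>, which bounds.\<close>

lemma rel_acyclic_at_of_acyclic:
  assumes "acyclic_at TYPE('r::ring_1) D d" "acyclic_at TYPE('r) L (d - 1)"
    "finite V" "D \<subseteq> Pow V" "L \<subseteq> D" "down_closed D"
  shows "rel_acyclic_at TYPE('r) D L d"
  unfolding rel_acyclic_at_def
proof (intro ballI impI)
  fix a :: "_ \<Rightarrow> 'r"
  assume a: "a \<in> simplicial_chains D d" and l: "simplicial_boundary a \<in> simplicial_chains L (d - 1)"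
  have "simplicial_boundary a \<in> simplicial_cycles L (d - 1)"
    using l simplicial_boundary_boundary[OF a assms(3,4,6)] by (simp add: simplicial_cycles_def)
  then obtain m where m: "m \<in> simplicial_chains L d" and am: "simplicial_boundary a = simplicial_boundary m"
    using assms(2) unfolding acyclic_at_def simplicial_boundaries_def by fastforce
  have mD: "m \<in> simplicial_chains D d" using m simplicial_chains_mono[OF assms(5)] by blast
  have "(\<lambda>xs. a xs - m xs) \<in> simplicial_cycles D d"
    using simplicial_chains_diff[OF a mD] simplicial_boundary_diff[OF a mD assms(3,4)]
    by (simp add: simplicial_cycles_def am)
  then obtain b where b: "b \<in> simplicial_chains D (d + 1)" and eq: "(\<lambda>xs. a xs - m xs) = simplicial_boundary b"
    using assms(1) unfolding acyclic_at_def simplicial_boundaries_def by fastforce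
  have "(\<lambda>xs. a xs - simplicial_boundary b xs) = m"
    unfolding eq[symmetric] by simp
  then show "\<exists>b\<in>simplicial_chains D (d + 1). (\<lambda>xs. a xs - simplicial_boundary b xs) \<in> simplicial_chains L d"
    using m by (intro bexI[OF _ b]) simp
qed

text \<open>Exactness of H_d(K, L) -> H_d(D, L) -> H_d(D, K) in the middle: a is first pushed into
  \<open>K\<close> by a boundary, then from \<open>K\<close> into \<open>L\<close>, and the two
  bounding chains are added.\<close>

lemma rel_acyclic_at_trans:
  assumes "rel_acyclic_at TYPE('r::ring_1) D K d" "rel_acyclic_at TYPE('r) K L d"
    "finite V" "D \<subseteq> Pow V" "K \<subseteq> D" "L \<subseteq> K" "down_closed D"
  shows "rel_acyclic_at TYPE('r) D L d"
  unfolding rel_acyclic_at_def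
proof (intro ballI impI)
  fix a :: "_ \<Rightarrow> 'r"
  assume a: "a \<in> simplicial_chains D d" and l: "simplicial_boundary a \<in> simplicial_chains L (d - 1)"
  then have "simplicial_boundary a \<in> simplicial_chains K (d - 1)"
    using simplicial_chains_mono[OF assms(6)] by blast
  with assms(1) a obtain b where b: "b \<in> simplicial_chains D (d + 1)"
    and k: "(\<lambda>xs. a xs - simplicial_boundary b xs) \<in> simplicial_chains K d"
    unfolding rel_acyclic_at_def by blast
  have bb: "simplicial_boundary b \<in> simplicial_chains D d"
    using simplicial_boundary_in_chains[OF b assms(3,4,7)] by simp
  have "simplicial_boundary (\<lambda>xs. a xs - simplicial_boundary b xs) = simplicial_boundary a"
    unfolding simplicial_boundary_diff[OF a bb assms(3,4)] simplicial_boundary_boundary[OF b assms(3,4,7)]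
    by simp
  with l have "simplicial_boundary (\<lambda>xs. a xs - simplicial_boundary b xs) \<in> simplicial_chains L (d - 1)"
    by simp
  with bspec[OF assms(2)[unfolded rel_acyclic_at_def] k]
  obtain c where c: "c \<in> simplicial_chains K (d + 1)"
    and m: "(\<lambda>xs. a xs - simplicial_boundary b xs - simplicial_boundary c xs) \<in> simplicial_chains L d"
    by blast
  have cD: "c \<in> simplicial_chains D (d + 1)" using c simplicial_chains_mono[OF assms(5)] by blast
  have cn: "(\<lambda>xs. - c xs) \<in> simplicial_chains D (d + 1)" by (rule simplicial_chains_uminus[OF cD])
  have "simplicial_boundary (\<lambda>xs. b xs - - c xs) = (\<lambda>xs. simplicial_boundary b xs - simplicial_boundary (\<lambda>xs. - c xs) xs)"
    by (rule simplicial_boundary_diff[OF b cn assms(3,4)])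
  moreover have "simplicial_boundary (\<lambda>xs. - c xs) = (\<lambda>xs. - simplicial_boundary c xs)"
    using simplicial_boundary_diff[OF simplicial_chains_zero cD assms(3,4)]
    by (simp add: simplicial_boundary_zero)
  ultimately have eq: "simplicial_boundary (\<lambda>xs. b xs + c xs) = (\<lambda>xs. simplicial_boundary b xs + simplicial_boundary c xs)"
    by simp
  show "\<exists>b\<in>simplicial_chains D (d + 1). (\<lambda>xs. a xs - simplicial_boundary b xs) \<in> simplicial_chains L d"
    by (rule bexI[OF _ simplicial_chains_add[OF b cD]]) (use m in \<open>simp add: eq diff_diff_eq\<close>)
qed

section \<open>Matroid rank\<close>

definition rank_in :: "'v set set \<Rightarrow> 'v set \<Rightarrow> nat" where
  "rank_in M S = Max (card ` {A \<in> M. A \<subseteq> S})"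

definition delete_elt :: "'v \<Rightarrow> 'v set set \<Rightarrow> 'v set set" where
  "delete_elt v M = {A \<in> M. v \<notin> A}"

text \<open>Like \<open>delete_elt\<close> it is applied to complexes as well, where the two are the
  link and the deletion of \<open>v\<close>. Contracting a loop of a matroid yields the empty
  family, so contractions are taken as matroids only under \<open>{v} \<in> M\<close>.\<close>

definition contract_elt :: "'v \<Rightarrow> 'v set set \<Rightarrow> 'v set set" where
  "contract_elt v M = {A. v \<notin> A \<and> insert v A \<in> M}"

lemma matroidD:
  assumes "matroid E M"
  shows "M \<subseteq> Pow E" "{} \<in> M" "A \<in> M \<Longrightarrow> B \<subseteq> A \<Longrightarrow> B \<in> M"
    "A \<in> M \<Longrightarrow> B \<in> M \<Longrightarrow> card A < card B \<Longrightarrow> \<exists>x\<in>B - A. insert x A \<in> M"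
  using assms unfolding matroid_def by (blast, fast, blast, blast)

lemma matroid_finite: "finite E \<Longrightarrow> matroid E M \<Longrightarrow> finite M"
  using matroidD(1) finite_subset by fastforce

lemma matroid_delete:
  assumes "matroid E M" shows "matroid (E - {v}) (delete_elt v M)"
  unfolding matroid_def
proof (intro conjI ballI allI impI)
  show "delete_elt v M \<subseteq> Pow (E - {v})"
    using matroidD(1)[OF assms] by (auto simp: delete_elt_def)
  show "delete_elt v M \<noteq> {}"
    using matroidD(2)[OF assms] by (auto simp: delete_elt_def)
  show "B \<in> delete_elt v M" if "A \<in> delete_elt v M" "B \<subseteq> A" for A B
    using that matroidD(3)[OF assms] by (auto simp: delete_elt_def)
  show "\<exists>x\<in>B - A. insert x A \<in> delete_elt v M"
    if "A \<in> delete_elt v M" "B \<in> delete_elt v M" "card A < card B" for A B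
    using that matroidD(4)[OF assms, of A B] by (auto simp: delete_elt_def)
qed

lemma matroid_contract:
  assumes "matroid E M" "finite E" "{v} \<in> M" shows "matroid (E - {v}) (contract_elt v M)"
  unfolding matroid_def
proof (intro conjI ballI allI impI)
  show "contract_elt v M \<subseteq> Pow (E - {v})"
    using matroidD(1)[OF assms(1)] by (auto simp: contract_elt_def)
  show "contract_elt v M \<noteq> {}"
    using assms(3) by (auto simp: contract_elt_def)
  show "B \<in> contract_elt v M" if "A \<in> contract_elt v M" "B \<subseteq> A" for A B
    using that matroidD(3)[OF assms(1), of "insert v A" "insert v B"] by (auto simp: contract_elt_def)
  show "\<exists>x\<in>B - A. insert x A \<in> contract_elt v M"
    if "A \<in> contract_elt v M" "B \<in> contract_elt v M" "card A < card B" for A B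
  proof -
    have AB: "v \<notin> A" "v \<notin> B" "insert v A \<in> M" "insert v B \<in> M"
      using that by (auto simp: contract_elt_def)
    then have "finite A" "finite B"
      using matroidD(1)[OF assms(1)] assms(2) by (meson Pow_iff finite_insert finite_subset subsetD)+
    then have "card (insert v A) < card (insert v B)" using AB that(3) by simp
    from matroidD(4)[OF assms(1) AB(3,4) this] AB show ?thesis
      by (auto simp: contract_elt_def insert_commute)
  qed
qed

locale finite_matroid =
  fixes E :: "'v set" and M :: "'v set set"
  assumes finite_E: "finite E" and matroid: "matroid E M"
begin

lemmas M_Pow = matroidD(1)[OF matroid]
lemmas M_empty = matroidD(2)[OF matroid]
lemmas M_down = matroidD(3)[OF matroid]
lemmas M_augment = matroidD(4)[OF matroid]

lemma finite_M: "finite M"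
  by (rule matroid_finite[OF finite_E matroid])

lemma finite_indep: "A \<in> M \<Longrightarrow> finite A"
  using M_Pow finite_E by (meson Pow_iff finite_subset subsetD)

lemma card_le_rank: "A \<in> M \<Longrightarrow> A \<subseteq> S \<Longrightarrow> card A \<le> rank_in M S"
  unfolding rank_in_def by (rule Max_ge) (use finite_M in auto)

lemma rank_basis: obtains A where "A \<in> M" "A \<subseteq> S" "card A = rank_in M S"
proof -
  have "rank_in M S \<in> card ` {A \<in> M. A \<subseteq> S}"
    unfolding rank_in_def by (rule Max_in) (use finite_M M_empty in auto)
  then show ?thesis using that by auto
qed

lemma extend_basis:
  assumes "I \<in> M" "I \<subseteq> S"
  obtains K where "K \<in> M" "I \<subseteq> K" "K \<subseteq> S" "card K = rank_in M S"
proof -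
  let ?P = "\<lambda>K. K \<in> M \<and> I \<subseteq> K \<and> K \<subseteq> S"
  have "\<exists>K. ?P K \<and> (\<forall>K'. ?P K' \<longrightarrow> card K' \<le> card K)"
    by (rule ex_has_greatest_nat[of _ I _ "Suc (rank_in M S)"]) (use assms card_le_rank in \<open>auto simp: less_Suc_eq_le\<close>)
  then obtain K where K: "?P K" and max: "\<And>K'. ?P K' \<Longrightarrow> card K' \<le> card K" by blast
  obtain B where B: "B \<in> M" "B \<subseteq> S" "card B = rank_in M S" by (rule rank_basis)
  have "\<not> card K < card B"
  proof
    assume "card K < card B"
    then obtain x where "x \<in> B - K" "insert x K \<in> M" using M_augment K B by blast
    then show False using max[of "insert x K"] K B finite_indep[of K] by auto
  qed
  then have "card K = rank_in M S" using card_le_rank[of K S] K B by auto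
  then show ?thesis using that K by blast
qed

lemma rank_mono: "S \<subseteq> T \<Longrightarrow> rank_in M S \<le> rank_in M T"
  by (metis card_le_rank rank_basis subset_trans)

lemma rank_empty: "rank_in M {} = 0"
  by (rule rank_basis[of "{}"]) auto

lemma rank_singleton: "rank_in M {v} \<le> 1"
proof -
  obtain A where "A \<subseteq> {v}" "card A = rank_in M {v}" by (rule rank_basis)
  then show ?thesis using card_mono[of "{v}" A] by simp
qed

lemma rank_loop:
  assumes "{v} \<notin> M" shows "rank_in M {v} = 0"
proof -
  obtain A where "A \<in> M" "A \<subseteq> {v}" "card A = rank_in M {v}" by (rule rank_basis)
  then show ?thesis using assms by (auto simp: subset_singleton_iff)
qed

text \<open>A basis I of A \<inter> B is extended to a basis K of A \<union> B. The parts of K in A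
  and in B are independent, cover K, and overlap at least in I.\<close>

lemma rank_submodular: "rank_in M (A \<union> B) + rank_in M (A \<inter> B) \<le> rank_in M A + rank_in M B"
proof -
  obtain I where I: "I \<in> M" "I \<subseteq> A \<inter> B" "card I = rank_in M (A \<inter> B)" by (rule rank_basis)
  then obtain K where K: "K \<in> M" "I \<subseteq> K" "K \<subseteq> A \<union> B" "card K = rank_in M (A \<union> B)"
    using extend_basis[of I "A \<union> B"] by blast
  have fin: "finite K" by (rule finite_indep[OF K(1)])
  have "card I \<le> card (K \<inter> A \<inter> (K \<inter> B))"
    by (rule card_mono) (use fin I K in auto)
  moreover have "card (K \<inter> A) + card (K \<inter> B) = card (K \<inter> A \<union> K \<inter> B) + card (K \<inter> A \<inter> (K \<inter> B))"
    by (rule card_Un_Int) (use fin in auto)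
  moreover have "K \<inter> A \<union> K \<inter> B = K" using K by auto
  moreover have "card (K \<inter> A) \<le> rank_in M A" "card (K \<inter> B) \<le> rank_in M B"
    using M_down[OF K(1)] by (auto intro!: card_le_rank)
  ultimately show ?thesis using I K by simp
qed

lemma rank_delete: "v \<notin> S \<Longrightarrow> rank_in (delete_elt v M) S = rank_in M S"
  unfolding rank_in_def delete_elt_def by (rule arg_cong[where f = "\<lambda>X. Max (card ` X)"]) auto

text \<open>A basis of \<open>insert v S\<close> can be chosen to contain \<open>v\<close>; without
  \<open>v\<close> it is independent in the contraction.\<close>

lemma rank_contract:
  assumes "{v} \<in> M" "v \<notin> S"
  shows "rank_in M (insert v S) \<le> rank_in (contract_elt v M) S + 1"
proof -
  interpret C: finite_matroid "E - {v}" "contract_elt v M"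
    using matroid_contract[OF matroid finite_E assms(1)] finite_E by unfold_locales auto
  obtain K where K: "K \<in> M" "{v} \<subseteq> K" "K \<subseteq> insert v S" "card K = rank_in M (insert v S)"
    using extend_basis[OF assms(1), of "insert v S"] by auto
  have "K - {v} \<in> contract_elt v M"
    using K by (auto simp: contract_elt_def insert_absorb)
  then have "card (K - {v}) \<le> rank_in (contract_elt v M) S"
    by (rule C.card_le_rank) (use K in auto)
  then show ?thesis using K by simp
qed

end

section \<open>Polymatroids\<close>

locale polymatroid_fun =
  fixes E :: "'v set" and f :: "'v set \<Rightarrow> real"
  assumes finite_E: "finite E" and f_empty: "f {} = 0"
    and f_nonneg: "S \<subseteq> E \<Longrightarrow> 0 \<le> f S"
    and f_submodular: "S \<subseteq> E \<Longrightarrow> T \<subseteq> E \<Longrightarrow> f (S \<union> T) + f (S \<inter> T) \<le> f S + f T"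
begin

text \<open>Only the upper bounds. Nonnegativity is carried separately, because one vector on the
  union of two ground sets will have to satisfy two such systems.\<close>

definition feasible :: "('v \<Rightarrow> real) \<Rightarrow> bool" where
  "feasible x \<longleftrightarrow> (\<forall>S\<subseteq>E. sum x S \<le> f S)"

definition tight :: "('v \<Rightarrow> real) \<Rightarrow> 'v set \<Rightarrow> bool" where
  "tight x S \<longleftrightarrow> S \<subseteq> E \<and> sum x S = f S"

text \<open>Uncrossing: x(S) + x(T) is split over union and intersection without loss, while the
  bounds can only shrink by submodularity, so neither of the two new inequalities can be
  strict.\<close>

lemma tight_Un_Int:
  assumes "feasible x" "tight x S" "tight x T"
  shows "tight x (S \<union> T)" "tight x (S \<inter> T)"
proof -
  have ST: "S \<subseteq> E" "T \<subseteq> E" "sum x S = f S" "sum x T = f T"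
    using assms by (auto simp: tight_def)
  then have "sum x (S \<union> T) \<le> f (S \<union> T)" "sum x (S \<inter> T) \<le> f (S \<inter> T)"
    using assms(1) unfolding feasible_def by (auto simp: le_infI1)
  moreover have "sum x (S \<union> T) + sum x (S \<inter> T) = sum x S + sum x T"
    by (rule sum.union_inter) (use ST finite_E finite_subset in auto)
  moreover have "f (S \<union> T) + f (S \<inter> T) \<le> f S + f T"
    using f_submodular ST by auto
  ultimately show "tight x (S \<union> T)" "tight x (S \<inter> T)"
    using ST by (auto simp: tight_def)
qed

lemma tight_empty: "tight x {}"
  by (simp add: tight_def f_empty)

lemma tight_Union:
  assumes "feasible x" "finite \<S>" "\<And>S. S \<in> \<S> \<Longrightarrow> tight x S"
  shows "tight x (\<Union>\<S>)"
  using assms(2,3) by induction (use tight_empty tight_Un_Int(1)[OF assms(1)] in auto)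

lemma tight_Inter:
  assumes "feasible x" "finite \<S>" "\<S> \<noteq> {}" "\<And>S. S \<in> \<S> \<Longrightarrow> tight x S"
  shows "tight x (\<Inter>\<S>)"
  using assms(2,3,4) by (induction rule: finite_ne_induct) (use tight_Un_Int(2)[OF assms(1)] in auto)

lemma finite_tight: "finite {S. tight x S}"
  by (rule finite_subset[of _ "Pow E"]) (use finite_E in \<open>auto simp: tight_def\<close>)

text \<open>Starting from 0, the coordinates are raised one after the other, each until it reaches
  \<open>x\<close> or some set containing it becomes tight. Later raises keep tight sets
  tight.\<close>

lemma greedy_maximal:
  assumes x0: "\<And>v. v \<in> E \<Longrightarrow> 0 \<le> x v" and U: "U \<subseteq> E"
  shows "\<exists>y. (\<forall>v\<in>U. 0 \<le> y v \<and> y v \<le> x v) \<and> (\<forall>v. v \<notin> U \<longrightarrow> y v = 0) \<and> feasible y \<and>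
    (\<forall>u\<in>U. y u = x u \<or> (\<exists>S. tight y S \<and> u \<in> S))"
  using finite_subset[OF U finite_E] U
proof (induction U)
  case empty
  show ?case by (rule exI[of _ "\<lambda>_. 0"]) (auto simp: feasible_def f_nonneg)
next
  case (insert u U)
  then obtain y where y: "\<forall>v\<in>U. 0 \<le> y v \<and> y v \<le> x v" "\<forall>v. v \<notin> U \<longrightarrow> y v = 0" "feasible y"
    "\<forall>u\<in>U. y u = x u \<or> (\<exists>S. tight y S \<and> u \<in> S)" by auto
  have uE: "u \<in> E" using insert by auto
  let ?\<S> = "{S. S \<subseteq> E \<and> u \<in> S}"
  have finS: "finite ?\<S>" using finite_E by auto
  define \<delta> where "\<delta> = min (x u) (Min ((\<lambda>S. f S - sum y S) ` ?\<S>))"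
  have S_ne: "?\<S> \<noteq> {}" using uE by auto
  have \<delta>_le: "\<delta> \<le> f S - sum y S" if "S \<subseteq> E" "u \<in> S" for S
    unfolding \<delta>_def by (rule min.coboundedI2, rule Min_le) (use that finS in auto)
  have \<delta>0: "0 \<le> \<delta>"
    unfolding \<delta>_def using finS S_ne x0[OF uE] y(3) by (auto simp: feasible_def)
  have \<delta>_cases: "\<delta> = x u \<or> (\<exists>S. S \<subseteq> E \<and> u \<in> S \<and> \<delta> = f S - sum y S)"
  proof (cases "\<delta> = x u")
    case False
    then have "\<delta> = Min ((\<lambda>S. f S - sum y S) ` ?\<S>)" unfolding \<delta>_def by (auto simp: min_def)
    moreover have "Min ((\<lambda>S. f S - sum y S) ` ?\<S>) \<in> (\<lambda>S. f S - sum y S) ` ?\<S>"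
      by (rule Min_in) (use finS S_ne in auto)
    ultimately show ?thesis by auto
  qed simp
  have yu: "y u = 0" using y(2) insert by auto
  define z where "z = y(u := \<delta>)"
  have sumz: "sum z S = sum y S + (if u \<in> S then \<delta> else 0)" if "S \<subseteq> E" for S
  proof -
    have fin: "finite S" using that finite_E finite_subset by auto
    show ?thesis
    proof (cases "u \<in> S")
      case True
      then have "sum z S = \<delta> + sum z (S - {u})" "sum y S = sum y (S - {u})"
        using sum.remove[OF fin True, of z] sum.remove[OF fin True, of y] yu by (auto simp: z_def)
      moreover have "sum z (S - {u}) = sum y (S - {u})" by (rule sum.cong) (auto simp: z_def)
      ultimately show ?thesis using True by simp
    next
      case False
      then have "sum z S = sum y S" by (intro sum.cong) (auto simp: z_def)
      then show ?thesis using False by simp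
    qed
  qed
  have feas: "feasible z"
    unfolding feasible_def using sumz \<delta>_le y(3) by (auto simp: feasible_def algebra_simps)
  have tight_keep: "tight z S" if "tight y S" for S
  proof -
    have "sum z S \<ge> f S" "S \<subseteq> E" using that sumz[of S] \<delta>0 by (auto simp: tight_def)
    moreover from this feas have "sum z S \<le> f S" by (auto simp: feasible_def)
    ultimately show ?thesis by (auto simp: tight_def)
  qed
  show ?case
  proof (intro exI[of _ z] conjI ballI allI impI)
    show "0 \<le> z v" "z v \<le> x v" if "v \<in> insert u U" for v
      using that y(1) \<delta>0 by (auto simp: z_def \<delta>_def)
    show "z v = 0" if "v \<notin> insert u U" for v
      using that y(2) by (auto simp: z_def)
    show "feasible z" by (rule feas)
    show "z w = x w \<or> (\<exists>S. tight z S \<and> w \<in> S)" if "w \<in> insert u U" for w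
    proof (cases "w = u")
      case True
      from \<delta>_cases show ?thesis
      proof
        assume "\<delta> = x u"
        with True show ?thesis by (simp add: z_def)
      next
        assume "\<exists>S. S \<subseteq> E \<and> u \<in> S \<and> \<delta> = f S - sum y S"
        then obtain S where "S \<subseteq> E" "u \<in> S" "\<delta> = f S - sum y S" by blast
        with sumz[of S] have "tight z S" by (simp add: tight_def)
        with True \<open>u \<in> S\<close> show ?thesis by blast
      qed
    next
      case False
      then have "y w = x w \<or> (\<exists>S. tight y S \<and> w \<in> S)" using that y(4) by blast
      moreover have "z w = y w" using False by (simp add: z_def)
      ultimately show ?thesis using tight_keep by metis
    qed
  qed
qed

text \<open>For the greedy vector y let T be the union of all tight sets, itself tight. Outside T
  nothing was lost, and on T the loss is x(T) - f(T) \<le> c. So an excess of c on every single set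
  costs c only once.\<close>

lemma reduce_to_feasible:
  assumes x0: "\<And>v. v \<in> E \<Longrightarrow> 0 \<le> x v" and excess: "\<And>S. S \<subseteq> E \<Longrightarrow> sum x S \<le> f S + c"
  obtains y where "\<And>v. v \<in> E \<Longrightarrow> 0 \<le> y v" "\<And>v. y v \<le> x v" "\<And>v. v \<notin> E \<Longrightarrow> y v = x v"
    "feasible y" "sum x E - c \<le> sum y E"
proof -
  obtain y where y: "\<forall>v\<in>E. 0 \<le> y v \<and> y v \<le> x v" "feasible y"
    "\<forall>u\<in>E. y u = x u \<or> (\<exists>S. tight y S \<and> u \<in> S)"
    using greedy_maximal[of x E, OF x0] by auto
  define T where "T = \<Union>{S. tight y S}"
  have T: "tight y T"
    unfolding T_def by (rule tight_Union[OF y(2) finite_tight]) auto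
  then have TE: "T \<subseteq> E" "sum y T = f T" by (auto simp: tight_def)
  have "sum y (E - T) = sum x (E - T)"
    by (rule sum.cong) (use y(3) in \<open>auto simp: T_def\<close>)
  moreover have "sum y E = sum y (E - T) + sum y T" "sum x E = sum x (E - T) + sum x T"
    using sum.subset_diff[OF TE(1) finite_E] by auto
  ultimately have total: "sum x E - c \<le> sum y E" using excess[OF TE(1)] TE(2) by auto
  define z where "z = (\<lambda>v. if v \<in> E then y v else x v)"
  have zy: "sum z S = sum y S" if "S \<subseteq> E" for S
    by (rule sum.cong) (use that in \<open>auto simp: z_def\<close>)
  show ?thesis
    by (rule that[of z]) (use y(1,2) total zy in \<open>auto simp: z_def feasible_def\<close>)
qed

end

lemma (in finite_matroid) polymatroid_rank:
  assumes "0 \<le> c" shows "polymatroid_fun E (\<lambda>S. c * real (rank_in M S))"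
proof
  show "c * real (rank_in M (S \<union> T)) + c * real (rank_in M (S \<inter> T)) \<le> c * real (rank_in M S) + c * real (rank_in M T)" for S T
    using mult_left_mono[OF _ assms, of "real (rank_in M (S \<union> T) + rank_in M (S \<inter> T))" "real (rank_in M S + rank_in M T)"]
      rank_submodular[of S T] by (simp add: distrib_left)
qed (use finite_E assms rank_empty in auto)

section \<open>Extreme points\<close>

text \<open>Gaussian elimination: equation \<open>j\<close> is used as pivot row at
  \<open>v0\<close> to remove this unknown from all other equations.\<close>

lemma homogeneous_system_nontrivial:
  fixes a :: "'j \<Rightarrow> 'v \<Rightarrow> real"
  assumes "finite J" "finite U" "card J < card U"
  shows "\<exists>d. (\<exists>v\<in>U. d v \<noteq> 0) \<and> (\<forall>v. v \<notin> U \<longrightarrow> d v = 0) \<and> (\<forall>j\<in>J. (\<Sum>v\<in>U. a j v * d v) = 0)"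
  using assms
proof (induction J arbitrary: a U rule: finite_induct)
  case empty
  then obtain v0 where "v0 \<in> U" by fastforce
  then show ?case by (intro exI[of _ "\<lambda>v. if v = v0 then 1 else 0"]) auto
next
  case (insert j J)
  show ?case
  proof (cases "\<forall>v\<in>U. a j v = 0")
    case True
    have "card J < card U" using insert by simp
    from insert.IH[OF insert.prems(1) this, of a] True show ?thesis by auto
  next
    case False
    then obtain v0 where v0: "v0 \<in> U" "a j v0 \<noteq> 0" by blast
    define a' where "a' = (\<lambda>i v. a i v - a i v0 / a j v0 * a j v)"
    have "card J < card (U - {v0})" using insert v0 by simp
    from insert.IH[OF _ this, of a'] insert.prems(1)
    obtain d where d: "\<exists>v\<in>U - {v0}. d v \<noteq> 0" "\<forall>v. v \<notin> U - {v0} \<longrightarrow> d v = 0"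
      "\<forall>i\<in>J. (\<Sum>v\<in>U - {v0}. a' i v * d v) = 0" by blast
    define s where "s = (\<Sum>v\<in>U - {v0}. a j v * d v)"
    \<comment> \<open>The value at \<open>v0\<close> is the one that solves equation
      \<open>j\<close>; by the choice of \<open>a'\<close> the remaining equations then hold
      too.\<close>
    define e where "e = d(v0 := - s / a j v0)"
    have sum_e: "(\<Sum>v\<in>U. a i v * e v) = - (a i v0 / a j v0 * s) + (\<Sum>v\<in>U - {v0}. a i v * d v)" for i
    proof -
      have "(\<Sum>v\<in>U. a i v * e v) = a i v0 * e v0 + (\<Sum>v\<in>U - {v0}. a i v * e v)"
        by (rule sum.remove[OF insert.prems(1) v0(1)])
      moreover have "(\<Sum>v\<in>U - {v0}. a i v * e v) = (\<Sum>v\<in>U - {v0}. a i v * d v)"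
        by (rule sum.cong) (auto simp: e_def)
      ultimately show ?thesis by (simp add: e_def)
    qed
    have "(\<Sum>v\<in>U. a i v * e v) = 0" if "i \<in> insert j J" for i
    proof (cases "i = j")
      case True
      then show ?thesis using sum_e[of i] v0 by (simp add: s_def)
    next
      case False
      have "(\<Sum>v\<in>U - {v0}. a' i v * d v) = (\<Sum>v\<in>U - {v0}. a i v * d v) - a i v0 / a j v0 * s"
        unfolding a'_def s_def by (simp add: left_diff_distrib sum_subtractf sum_distrib_left mult.assoc)
      then show ?thesis using sum_e[of i] d(3) that False by simp
    qed
    moreover have "\<exists>v\<in>U. e v \<noteq> 0" using d(1) by (auto simp: e_def)
    moreover have "\<forall>v. v \<notin> U \<longrightarrow> e v = 0" using d(2) v0 by (auto simp: e_def)
    ultimately show ?thesis by blast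
  qed
qed

text \<open>Constraints are pairs \<open>(a, b)\<close> standing for \<open>\<Sum>v. a v * x v \<le> b\<close>. Among the feasible points
  with at least the total of \<open>x\<close>, one with the maximal number of tight constraints will do.\<close>

lemma extreme_point_exists:
  fixes I :: "(('v \<Rightarrow> real) \<times> real) set" and x :: "'v \<Rightarrow> real" and U :: "'v set"
  defines "lin \<equiv> \<lambda>i z. \<Sum>v\<in>U. fst i v * z v"
  assumes fin: "finite U" "finite I"
    and feas: "\<And>i. i \<in> I \<Longrightarrow> lin i x \<le> snd i"
    and bounded: "\<And>d. \<exists>v\<in>U. d v > 0 \<Longrightarrow> \<exists>i\<in>I. lin i d > 0"
  obtains y where "\<And>i. i \<in> I \<Longrightarrow> lin i y \<le> snd i" "sum x U \<le> sum y U"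
    "\<And>d v. (\<And>i. i \<in> I \<Longrightarrow> lin i y = snd i \<Longrightarrow> lin i d = 0) \<Longrightarrow> v \<in> U \<Longrightarrow> d v = 0"
proof -
  let ?P = "\<lambda>y. (\<forall>i\<in>I. lin i y \<le> snd i) \<and> sum x U \<le> sum y U"
  define T where "T = (\<lambda>y. {i \<in> I. lin i y = snd i})"
  have "\<exists>y. ?P y \<and> (\<forall>z. ?P z \<longrightarrow> card (T z) \<le> card (T y))"
    by (rule ex_has_greatest_nat[of _ x _ "Suc (card I)"])
      (use fin feas in \<open>auto simp: T_def less_Suc_eq_le intro!: card_mono\<close>)
  then obtain y where y: "?P y" and max: "\<And>z. ?P z \<Longrightarrow> card (T z) \<le> card (T y)" by blast
  have key: False if d: "\<And>i. i \<in> I \<Longrightarrow> lin i y = snd i \<Longrightarrow> lin i d = 0"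
    and d0: "\<exists>v\<in>U. d v \<noteq> 0" and ds: "0 \<le> sum d U" for d
  proof -
    \<comment> \<open>A nonzero direction with nonnegative total has a positive coordinate, so by
      boundedness some constraint eventually blocks the ray from \<open>y\<close> along
      \<open>d\<close>.\<close>
    have "\<exists>v\<in>U. d v > 0"
    proof (rule ccontr)
      assume "\<not> ?thesis"
      then have neg: "\<And>v. v \<in> U \<Longrightarrow> 0 \<le> - d v" by (auto simp: not_less)
      then have "0 \<le> (\<Sum>v\<in>U. - d v)" by (rule sum_nonneg)
      with ds have "(\<Sum>v\<in>U. - d v) = 0" by (simp add: sum_negf)
      then have "\<forall>v\<in>U. - d v = 0" using sum_nonneg_eq_0_iff[OF fin(1), of "\<lambda>v. - d v"] neg by blast
      with d0 show False by auto
    qed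
    from bounded[OF this] have ne: "{i \<in> I. lin i d > 0} \<noteq> {}" by blast
    let ?K = "{i \<in> I. lin i d > 0}" and ?r = "\<lambda>i. (snd i - lin i y) / lin i d"
    have finK: "finite ?K" using fin by auto
    \<comment> \<open>The largest step that stays feasible. The blocking constraint
      \<open>i0\<close> becomes tight, all old tight constraints stay so, and the total does not
      fall, against the maximality of \<open>y\<close>.\<close>
    define \<epsilon> where "\<epsilon> = Min (?r ` ?K)"
    have "\<epsilon> \<in> ?r ` ?K" unfolding \<epsilon>_def by (rule Min_in) (use finK ne in auto)
    then obtain i0 where i0: "i0 \<in> I" "lin i0 d > 0" "\<epsilon> = ?r i0" by blast
    have \<epsilon>0: "0 \<le> \<epsilon>" using i0 y by auto
    define z where "z = (\<lambda>v. y v + \<epsilon> * d v)"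
    have lin_z: "lin i z = lin i y + \<epsilon> * lin i d" for i
      unfolding lin_def z_def by (simp add: distrib_left sum.distrib sum_distrib_left mult.left_commute)
    have "lin i z \<le> snd i" if i: "i \<in> I" for i
    proof (cases "lin i d > 0")
      case True
      then have "\<epsilon> \<le> ?r i" unfolding \<epsilon>_def by (intro Min_le) (use finK i in auto)
      then show ?thesis using True by (simp add: lin_z pos_le_divide_eq)
    next
      case False
      then have "\<epsilon> * lin i d \<le> 0" using \<epsilon>0 by (simp add: mult_nonneg_nonpos)
      moreover have "lin i y \<le> snd i" using y i by blast
      ultimately show ?thesis by (simp add: lin_z)
    qed
    moreover have "sum z U = sum y U + \<epsilon> * sum d U"
      unfolding z_def by (simp add: sum.distrib sum_distrib_left)
    then have "sum x U \<le> sum z U" using y \<epsilon>0 ds by (simp add: add_increasing2)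
    ultimately have "card (T z) \<le> card (T y)" using max by blast
    moreover have "T y \<subseteq> T z" using d by (auto simp: T_def lin_z)
    moreover have "i0 \<in> T z" using i0 by (simp add: T_def lin_z)
    moreover have "i0 \<notin> T y" using i0(2) d[OF i0(1)] by (auto simp: T_def)
    moreover have "finite (T z)" using fin by (simp add: T_def)
    ultimately show False by (metis card_subset_eq card_mono order_antisym)
  qed
  show ?thesis
  proof (rule that[of y])
    fix d v assume d: "\<And>i. i \<in> I \<Longrightarrow> lin i y = snd i \<Longrightarrow> lin i d = 0" and v: "v \<in> U"
    have neg: "lin i (\<lambda>u. - d u) = - lin i d" for i
      unfolding lin_def by (simp add: sum_negf)
    show "d v = 0"
    proof (rule ccontr)
      assume "d v \<noteq> 0"
      then have "\<exists>v\<in>U. d v \<noteq> 0" "\<exists>v\<in>U. - d v \<noteq> 0" using v by auto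
      \<comment> \<open>Whichever of d and -d does not decrease the total is the direction to move
        in.\<close>
      moreover have "0 \<le> sum d U \<or> 0 \<le> (\<Sum>v\<in>U. - d v)" by (auto simp: sum_negf)
      ultimately show False using key[of d] key[of "\<lambda>u. - d u"] d neg by auto
    qed
  qed (use y in auto)
qed

text \<open>The classes are the atoms of the lattice of tight sets, restricted to the support of \<open>y\<close>.\<close>

lemma (in polymatroid_fun) tight_classes:
  assumes feas: "feasible y" and X: "X \<subseteq> E" and y0: "\<And>v. v \<in> E - X \<Longrightarrow> y v = 0"
  obtains \<A> where "finite \<A>" "\<forall>A\<in>\<A>. A \<subseteq> X" "{} \<notin> \<A>"
    "\<forall>A\<in>\<A>. \<forall>B\<in>\<A>. A \<noteq> B \<longrightarrow> A \<inter> B = {}"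
    "\<forall>d :: 'v \<Rightarrow> real. (\<forall>A\<in>\<A>. sum d A = 0) \<longrightarrow> (\<forall>v\<in>E - X. d v = 0) \<longrightarrow>
      (\<forall>S. tight y S \<longrightarrow> sum d S = 0)"
    "\<forall>v. {v} \<in> \<A> \<longrightarrow> (\<exists>S T. tight y S \<and> tight y T \<and> y v = f S - f T)"
proof -
  \<comment> \<open>Two elements are equivalent if the same tight sets contain them. An element
    lying in no tight set is left without a class in \<open>\<A>\<close>.\<close>
  define cls where "cls = (\<lambda>v. {u \<in> X. \<forall>S. tight y S \<longrightarrow> (u \<in> S \<longleftrightarrow> v \<in> S)})"
  define \<A> where "\<A> = cls ` {v \<in> X. \<exists>S. tight y S \<and> v \<in> S}"
  have finX: "finite X" using X finite_E finite_subset by blast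
  have finA: "finite \<A>" using finX by (simp add: \<A>_def)
  have subX: "A \<subseteq> X" if "A \<in> \<A>" for A using that by (auto simp: \<A>_def cls_def)
  have ne: "{} \<notin> \<A>" by (auto simp: \<A>_def cls_def)
  have cls_eq: "cls u = cls v" if "u \<in> cls v" for u v
    using that unfolding cls_def by blast
  have disj: "A \<inter> B = {}" if "A \<in> \<A>" "B \<in> \<A>" "A \<noteq> B" for A B
    using that cls_eq unfolding \<A>_def by blast
  have null: "sum d S = 0" if d: "\<And>A. A \<in> \<A> \<Longrightarrow> sum d A = 0"
    and d0: "\<And>v. v \<in> E - X \<Longrightarrow> d v = 0" and S: "tight y S" for d :: "'v \<Rightarrow> real" and S
  proof -
    have SE: "S \<subseteq> E" using S by (simp add: tight_def)
    have "\<Union>{A \<in> \<A>. A \<subseteq> S} = S \<inter> X"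
    proof
      show "\<Union>{A \<in> \<A>. A \<subseteq> S} \<subseteq> S \<inter> X" using subX by blast
      show "S \<inter> X \<subseteq> \<Union>{A \<in> \<A>. A \<subseteq> S}"
      proof
        fix v assume v: "v \<in> S \<inter> X"
        then have "cls v \<in> \<A>" "v \<in> cls v" "cls v \<subseteq> S"
          using S by (auto simp: \<A>_def cls_def)
        then show "v \<in> \<Union>{A \<in> \<A>. A \<subseteq> S}" by blast
      qed
    qed
    moreover have "sum d (\<Union>{A \<in> \<A>. A \<subseteq> S}) = (sum \<circ> sum) d {A \<in> \<A>. A \<subseteq> S}"
      by (rule sum.Union_disjoint) (use finite_subset[OF subX finX] disj in auto)
    moreover have "(sum \<circ> sum) d {A \<in> \<A>. A \<subseteq> S} = 0"
      unfolding comp_def by (rule sum.neutral) (use d in blast)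
    moreover have "sum d S = sum d (S \<inter> X)"
      by (rule sum.mono_neutral_right) (use SE finite_subset[OF SE finite_E] d0 in auto)
    ultimately show ?thesis by simp
  qed
  have single: "\<exists>S T. tight y S \<and> tight y T \<and> y v = f S - f T" if "{v} \<in> \<A>" for v
  proof -
    have v: "cls v = {v}" "v \<in> X" "\<exists>S. tight y S \<and> v \<in> S"
    proof -
      obtain w where w: "w \<in> X" "\<exists>S. tight y S \<and> w \<in> S" "{v} = cls w"
        using \<open>{v} \<in> \<A>\<close> unfolding \<A>_def by blast
      moreover have "w \<in> cls w" using w(1) by (simp add: cls_def)
      ultimately have "w = v" by blast
      with w show "cls v = {v}" "v \<in> X" "\<exists>S. tight y S \<and> v \<in> S" by auto
    qed
    \<comment> \<open>\<open>S1\<close> is the least tight set containing \<open>v\<close> and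
      \<open>S2\<close> the largest tight subset of \<open>S1\<close> avoiding \<open>v\<close>.
      Inside \<open>X\<close> they differ exactly by the class of \<open>v\<close>, which makes
      \<open>y v\<close> a difference of two values of \<open>f\<close>.\<close>
    define S1 where "S1 = \<Inter>{S. tight y S \<and> v \<in> S}"
    define S2 where "S2 = \<Union>{S. tight y S \<and> S \<subseteq> S1 \<and> v \<notin> S}"
    have S1: "tight y S1" unfolding S1_def
      by (rule tight_Inter[OF feas]) (use v(3) finite_tight in auto)
    have S2: "tight y S2" unfolding S2_def
      by (rule tight_Union[OF feas]) (use finite_tight in auto)
    have "S2 \<subseteq> S1" unfolding S2_def by blast
    have S1E: "S1 \<subseteq> E" using S1 by (simp add: tight_def)
    then have "finite S1" by (rule finite_subset[OF _ finite_E])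
    note S1E = S1E this
    have "S1 \<inter> X - S2 = {v}"
    proof
      show "{v} \<subseteq> S1 \<inter> X - S2" using v(2) by (auto simp: S1_def S2_def)
      show "S1 \<inter> X - S2 \<subseteq> {v}"
      proof
        fix u assume u: "u \<in> S1 \<inter> X - S2"
        have "u \<in> S \<longleftrightarrow> v \<in> S" if S: "tight y S" for S
        proof
          assume "v \<in> S" then show "u \<in> S" using u S by (auto simp: S1_def)
        next
          assume uS: "u \<in> S"
          show "v \<in> S"
          proof (rule ccontr)
            assume "v \<notin> S"
            moreover have "tight y (S \<inter> S1)" by (rule tight_Un_Int(2)[OF feas S S1])
            ultimately have "S \<inter> S1 \<subseteq> S2" unfolding S2_def by blast
            then show False using u uS by blast
          qed
        qed
        then have "u \<in> cls v" using u by (simp add: cls_def)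
        then show "u \<in> {v}" using v(1) by simp
      qed
    qed
    moreover have "sum y S1 = sum y (S1 - S2) + sum y S2"
      by (rule sum.subset_diff) (use S1E \<open>S2 \<subseteq> S1\<close> in auto)
    moreover have "sum y (S1 - S2) = sum y (S1 \<inter> X - S2)"
      by (rule sum.mono_neutral_right) (use S1E y0 in auto)
    ultimately have "y v = f S1 - f S2" using S1 S2 by (simp add: tight_def)
    then show ?thesis using S1 S2 by blast
  qed
  show ?thesis
  proof (rule that[OF finA _ ne])
    show "\<forall>A\<in>\<A>. A \<subseteq> X" by (intro ballI subX)
    show "\<forall>A\<in>\<A>. \<forall>B\<in>\<A>. A \<noteq> B \<longrightarrow> A \<inter> B = {}" by (intro ballI impI disj)
    show "\<forall>d :: 'v \<Rightarrow> real. (\<forall>A\<in>\<A>. sum d A = 0) \<longrightarrow> (\<forall>v\<in>E - X. d v = 0) \<longrightarrow>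
        (\<forall>S. tight y S \<longrightarrow> sum d S = 0)"
      by (intro allI impI, rule null) (erule (1) bspec | assumption)+
    show "\<forall>v. {v} \<in> \<A> \<longrightarrow> (\<exists>S T. tight y S \<and> tight y T \<and> y v = f S - f T)"
      by (intro allI impI single)
  qed
qed

text \<open>Every class weighs at least 1: it has an element outside \<open>W\<close>, or two
  elements of \<open>W\<close>, as no single element of \<open>W\<close> is a class. Equality forces
  the classes to cover \<open>X\<close> and each to weigh exactly 1; a class with elements both in
  and outside \<open>W\<close> would weigh at least 3/2.\<close>

lemma class_count:
  fixes X W :: "'v set" and \<A> :: "'v set set"
  defines "wt \<equiv> \<lambda>v. if v \<in> W then 1 / 2 else (1 :: real)"
  assumes X: "finite X" "W \<subseteq> X" and A: "finite \<A>" "\<And>A. A \<in> \<A> \<Longrightarrow> A \<subseteq> X" "{} \<notin> \<A>"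
    and disj: "\<And>A B. A \<in> \<A> \<Longrightarrow> B \<in> \<A> \<Longrightarrow> A \<noteq> B \<Longrightarrow> A \<inter> B = {}"
    and single: "\<And>v. v \<in> W \<Longrightarrow> {v} \<notin> \<A>"
  shows "real (card \<A>) \<le> sum wt X"
    and "real (card \<A>) = sum wt X \<Longrightarrow> \<Union>{A \<in> \<A>. A \<subseteq> W} = W"
proof -
  have finA: "finite A" if "A \<in> \<A>" for A using that A X finite_subset by blast
  have wt0: "0 < wt v" for v by (simp add: wt_def)
  have ge1: "1 \<le> sum wt A" if "A \<in> \<A>" for A
  proof (cases "A \<subseteq> W")
    case True
    obtain v where v: "v \<in> A" using A(3) \<open>A \<in> \<A>\<close> by (metis equals0I)
    with single True \<open>A \<in> \<A>\<close> have "A \<noteq> {v}" by blast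
    then obtain w where w: "w \<in> A" "w \<noteq> v" using v by blast
    have "sum wt {v, w} \<le> sum wt A"
      by (rule sum_mono2) (use finA[OF \<open>A \<in> \<A>\<close>] v w wt0 in \<open>auto intro: less_imp_le\<close>)
    moreover have "sum wt {v, w} = 1" using v w True by (auto simp: wt_def)
    ultimately show ?thesis by simp
  next
    case False
    then obtain v where v: "v \<in> A" "v \<notin> W" by blast
    have "sum wt {v} \<le> sum wt A"
      by (rule sum_mono2) (use finA[OF \<open>A \<in> \<A>\<close>] v wt0 in \<open>auto intro: less_imp_le\<close>)
    then show ?thesis using v by (simp add: wt_def)
  qed
  have sum_Un: "sum wt (\<Union>\<A>) = (\<Sum>A\<in>\<A>. sum wt A)"
    using sum.Union_disjoint[of \<A> wt] finA disj by auto
  have c1: "real (card \<A>) \<le> (\<Sum>A\<in>\<A>. sum wt A)"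
    using sum_mono[of \<A> "\<lambda>_. 1" "sum wt", OF ge1] by simp
  have Un_sub: "\<Union>\<A> \<subseteq> X" using A(2) by blast
  have c2: "sum wt (\<Union>\<A>) \<le> sum wt X"
    by (rule sum_mono2) (use X Un_sub wt0 in \<open>auto intro: less_imp_le\<close>)
  show "real (card \<A>) \<le> sum wt X" using c1 c2 sum_Un by simp
  assume eq: "real (card \<A>) = sum wt X"
  have "sum wt X = sum wt (X - \<Union>\<A>) + sum wt (\<Union>\<A>)"
    by (rule sum.subset_diff[OF Un_sub X(1)])
  then have "sum wt (X - \<Union>\<A>) = 0"
    using eq c1 c2 sum_Un by simp
  then have "\<forall>v\<in>X - \<Union>\<A>. wt v = 0"
    using sum_nonneg_eq_0_iff[of "X - \<Union>\<A>" wt] X(1) wt0 by (auto intro: less_imp_le)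
  moreover have "wt v \<noteq> 0" for v using wt0[of v] by simp
  ultimately have cover: "X \<subseteq> \<Union>\<A>" by blast
  have "(\<Sum>A\<in>\<A>. sum wt A - 1) = 0"
    using eq c1 c2 sum_Un by (simp add: sum_subtractf)
  then have one: "\<forall>A\<in>\<A>. sum wt A - 1 = 0"
    using sum_nonneg_eq_0_iff[OF A(1), of "\<lambda>A. sum wt A - 1"] ge1 by auto
  have sub: "A \<subseteq> W" if "A \<in> \<A>" "w \<in> A" "w \<in> W" for A w
  proof (rule ccontr)
    assume "\<not> A \<subseteq> W"
    then obtain v where v: "v \<in> A" "v \<notin> W" by blast
    have "sum wt {v, w} \<le> sum wt A"
      by (rule sum_mono2) (use finA[OF that(1)] v that wt0 in \<open>auto intro: less_imp_le\<close>)
    moreover have "v \<noteq> w" using v that by blast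
    then have "sum wt {v, w} = 3 / 2" using v that by (simp add: wt_def)
    moreover from one that(1) have "sum wt A - 1 = 0" by blast
    ultimately show False by linarith
  qed
  have "w \<in> \<Union>{A \<in> \<A>. A \<subseteq> W}" if "w \<in> W" for w
  proof -
    have "w \<in> \<Union>\<A>" using subsetD[OF cover subsetD[OF X(2) that]] .
    then obtain A where "A \<in> \<A>" "w \<in> A" by (elim UnionE)
    with sub[OF this that] show ?thesis by auto
  qed
  moreover have "\<Union>{A \<in> \<A>. A \<subseteq> W} \<subseteq> W" by auto
  ultimately show "\<Union>{A \<in> \<A>. A \<subseteq> W} = W" by (meson subset_antisym subsetI)
qed

lemma sum_indicator_mult_subset:
  fixes z :: "'v \<Rightarrow> real"
  assumes "finite U" "S \<subseteq> U"
  shows "(\<Sum>v\<in>U. indicator S v * z v) = sum z S"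
proof -
  have "(\<Sum>v\<in>U. indicator S v * z v) = (\<Sum>v\<in>S. indicator S v * z v)"
    by (rule sum.mono_neutral_right) (use assms in \<open>auto simp: indicator_def\<close>)
  also have "\<dots> = sum z S" by (rule sum.cong) auto
  finally show ?thesis .
qed

abbreviation rank_feasible :: "real \<Rightarrow> 'v set \<Rightarrow> 'v set set \<Rightarrow> ('v \<Rightarrow> real) \<Rightarrow> bool" where
  "rank_feasible c E M \<equiv> polymatroid_fun.feasible E (\<lambda>S. c * real (rank_in M S))"

lemma (in finite_matroid) rank_feasible_iff:
  "0 \<le> c \<Longrightarrow> rank_feasible c E M x \<longleftrightarrow> (\<forall>S\<subseteq>E. sum x S \<le> c * real (rank_in M S))"
  using polymatroid_fun.feasible_def[OF polymatroid_rank] by blast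

text \<open>The value is a positive integer multiple of \<open>c\<close>, and the rank bound on
  \<open>{v}\<close> keeps it at most \<open>c\<close>.\<close>

lemma (in finite_matroid) singleton_class_full:
  assumes "0 < c" "rank_feasible c E M y" "v \<in> E" "0 < y v"
    "y v = c * real (rank_in M S) - c * real (rank_in M T)"
  shows "y v = c"
proof -
  have "sum y {v} \<le> c * real (rank_in M {v})"
    using assms rank_feasible_iff[of c y] by (metis empty_subsetI insert_subset less_imp_le)
  also have "\<dots> \<le> c * 1"
    by (rule mult_left_mono) (use rank_singleton[of v] assms(1) in auto)
  finally have le: "y v \<le> c" by simp
  define k where "k = int (rank_in M S) - int (rank_in M T)"
  have yk: "y v = c * real_of_int k" using assms(5) by (simp add: k_def right_diff_distrib)
  then have "0 < real_of_int k" using assms(1,4) by (simp add: zero_less_mult_iff)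
  moreover have "real_of_int k \<le> 1" using le yk assms(1) by simp
  ultimately have "k = 1" by linarith
  then show ?thesis using yk by simp
qed

text \<open>If no element of \<open>E \<inter> F\<close> were as claimed, giving weight \<open>1/2\<close> to the
  elements of \<open>E \<inter> F\<close> in each of their two classes shows that the tight constraints impose too
  few conditions to determine an extreme point.\<close>

lemma extreme_feasible_leaf:
  fixes p q :: real and x :: "'v \<Rightarrow> real"
  assumes EM: "finite_matroid E M" and FN: "finite_matroid F N" and pq: "0 < p" "0 < q"
    and W: "E \<inter> F \<noteq> {}" and x0: "\<And>v. v \<in> E \<union> F \<Longrightarrow> 0 \<le> x v"
    and xM: "rank_feasible p E M x" and xN: "rank_feasible q F N x"
  obtains y v where "\<And>v. v \<in> E \<union> F \<Longrightarrow> 0 \<le> y v" "rank_feasible p E M y" "rank_feasible q F N y"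
    "sum x (E \<union> F) \<le> sum y (E \<union> F)" "v \<in> E \<inter> F" "y v = 0 \<or> y v = p \<or> y v = q"
proof -
  interpret M: finite_matroid E M by (rule EM)
  interpret N: finite_matroid F N by (rule FN)
  interpret P: polymatroid_fun E "\<lambda>S. p * real (rank_in M S)"
    by (rule M.polymatroid_rank) (use pq in simp)
  interpret Q: polymatroid_fun F "\<lambda>S. q * real (rank_in N S)"
    by (rule N.polymatroid_rank) (use pq in simp)
  define U where "U = E \<union> F"
  have finU: "finite U" using M.finite_E N.finite_E by (simp add: U_def)
  have EU: "E \<subseteq> U" and FU: "F \<subseteq> U" by (auto simp: U_def)
  define cM where "cM = (\<lambda>S :: 'v set. (indicator S :: 'v \<Rightarrow> real, p * real (rank_in M S)))"
  define cN where "cN = (\<lambda>S :: 'v set. (indicator S :: 'v \<Rightarrow> real, q * real (rank_in N S)))"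
  define c0 where "c0 = (\<lambda>v :: 'v. (\<lambda>u. - indicator {v} u :: real, 0 :: real))"
  define I where "I = cM ` Pow E \<union> cN ` Pow F \<union> c0 ` U"
  define lin where "lin = (\<lambda>i :: ('v \<Rightarrow> real) \<times> real. \<lambda>z. \<Sum>v\<in>U. fst i v * z v)"
  have lin_M: "lin (cM S) z = sum z S" if "S \<subseteq> E" for S z
    unfolding lin_def cM_def using sum_indicator_mult_subset[OF finU subset_trans[OF that EU]] by simp
  have lin_N: "lin (cN S) z = sum z S" if "S \<subseteq> F" for S z
    unfolding lin_def cN_def using sum_indicator_mult_subset[OF finU subset_trans[OF that FU]] by simp
  have lin_0: "lin (c0 v) z = - z v" if "v \<in> U" for v z
    unfolding lin_def c0_def using sum_indicator_mult_subset[OF finU, of "{v}" z] that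
    by (simp add: sum_negf)
  have finI: "finite I"
    unfolding I_def using finU M.finite_E N.finite_E by simp
  have feas: "lin i x \<le> snd i" if "i \<in> I" for i
    using that unfolding I_def
  proof (elim UnE imageE)
    fix S assume "i = cM S" "S \<in> Pow E"
    then show ?thesis using lin_M[of S x] xM by (simp add: P.feasible_def cM_def)
  next
    fix S assume "i = cN S" "S \<in> Pow F"
    then show ?thesis using lin_N[of S x] xN by (simp add: Q.feasible_def cN_def)
  next
    fix v assume "i = c0 v" "v \<in> U"
    then show ?thesis using lin_0[of v x] x0[of v] by (simp add: U_def c0_def)
  qed
  \<comment> \<open>Every coordinate is capped by the rank constraint of its singleton in one of the
    two matroids.\<close>
  have bounded: "\<exists>i\<in>I. lin i d > 0" if "\<exists>v\<in>U. d v > 0" for d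
  proof -
    from that obtain v where v: "v \<in> U" "d v > 0" by blast
    show ?thesis
    proof (cases "v \<in> E")
      case True
      then show ?thesis using lin_M[of "{v}" d] v by (intro bexI[of _ "cM {v}"]) (auto simp: I_def)
    next
      case False
      then have "v \<in> F" using v by (simp add: U_def)
      then show ?thesis using lin_N[of "{v}" d] v by (intro bexI[of _ "cN {v}"]) (auto simp: I_def)
    qed
  qed
  obtain y where y_feas: "\<And>i. i \<in> I \<Longrightarrow> lin i y \<le> snd i" and y_total: "sum x U \<le> sum y U"
    and y_ext: "\<And>d v. (\<And>i. i \<in> I \<Longrightarrow> lin i y = snd i \<Longrightarrow> lin i d = 0) \<Longrightarrow> v \<in> U \<Longrightarrow> d v = 0"
  proof (rule extreme_point_exists[OF finU finI feas[unfolded lin_def] bounded[unfolded lin_def]])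
    fix y assume "\<And>i. i \<in> I \<Longrightarrow> (\<Sum>v\<in>U. fst i v * y v) \<le> snd i" "sum x U \<le> sum y U"
      "\<And>d v. (\<And>i. i \<in> I \<Longrightarrow> (\<Sum>v\<in>U. fst i v * y v) = snd i \<Longrightarrow> (\<Sum>v\<in>U. fst i v * d v) = 0)
        \<Longrightarrow> v \<in> U \<Longrightarrow> d v = 0"
    then show thesis by (rule that[unfolded lin_def])
  qed
  have y0: "0 \<le> y v" if "v \<in> U" for v
    using y_feas[of "c0 v"] lin_0[OF that] that by (simp add: I_def c0_def)
  have yM: "P.feasible y"
    unfolding P.feasible_def
  proof (intro allI impI)
    fix S assume S: "S \<subseteq> E"
    then have "cM S \<in> I" by (simp add: I_def)
    from y_feas[OF this] show "sum y S \<le> p * real (rank_in M S)"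
      unfolding lin_M[OF S] by (simp add: cM_def)
  qed
  have yN: "Q.feasible y"
    unfolding Q.feasible_def
  proof (intro allI impI)
    fix S assume S: "S \<subseteq> F"
    then have "cN S \<in> I" by (simp add: I_def)
    from y_feas[OF this] show "sum y S \<le> q * real (rank_in N S)"
      unfolding lin_N[OF S] by (simp add: cN_def)
  qed
  have "\<exists>v\<in>E \<inter> F. y v = 0 \<or> y v = p \<or> y v = q"
  proof (rule ccontr)
    assume "\<not> ?thesis"
    then have no: "y v \<noteq> 0" "y v \<noteq> p" "y v \<noteq> q" if "v \<in> E \<inter> F" for v using that by auto
    define Z where "Z = {v \<in> U. y v \<noteq> 0}"
    have finZ: "finite Z" using finU by (simp add: Z_def)
    have WZ: "E \<inter> F \<subseteq> Z" using no by (auto simp: Z_def U_def)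
    \<comment> \<open>A nonzero direction supported on \<open>Z\<close> that sums to zero over all
      tight sets of both matroids respects every tight constraint: the tight nonnegativity
      constraints belong to coordinates outside \<open>Z\<close>. An extreme point has no such
      direction.\<close>
    have no_null: False
      if "\<And>S. P.tight y S \<Longrightarrow> sum d S = 0" "\<And>S. Q.tight y S \<Longrightarrow> sum d S = 0"
        "\<And>v. v \<notin> Z \<Longrightarrow> d v = 0" "\<exists>v\<in>Z. d v \<noteq> 0" for d :: "'v \<Rightarrow> real"
    proof -
      have "lin i d = 0" if i: "i \<in> I" and t: "lin i y = snd i" for i
        using i unfolding I_def
      proof (elim UnE imageE)
        fix S assume "i = cM S" "S \<in> Pow E"
        then show ?thesis using t lin_M[of S] \<open>\<And>S. P.tight y S \<Longrightarrow> sum d S = 0\<close>[of S]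
          by (simp add: P.tight_def cM_def)
      next
        fix S assume "i = cN S" "S \<in> Pow F"
        then show ?thesis using t lin_N[of S] \<open>\<And>S. Q.tight y S \<Longrightarrow> sum d S = 0\<close>[of S]
          by (simp add: Q.tight_def cN_def)
      next
        fix v assume "i = c0 v" "v \<in> U"
        then show ?thesis using t lin_0[of v] \<open>\<And>v. v \<notin> Z \<Longrightarrow> d v = 0\<close>[of v]
          by (simp add: Z_def c0_def)
      qed
      from y_ext[OF this] that(4) show False by (auto simp: Z_def)
    qed
    have y_off_E: "y v = 0" if "v \<in> E - Z \<inter> E" for v using that EU by (auto simp: Z_def)
    have y_off_F: "y v = 0" if "v \<in> F - Z \<inter> F" for v using that FU by (auto simp: Z_def)
    obtain \<A> where A: "finite \<A>" "\<forall>A\<in>\<A>. A \<subseteq> Z \<inter> E" "{} \<notin> \<A>"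
      "\<forall>A\<in>\<A>. \<forall>B\<in>\<A>. A \<noteq> B \<longrightarrow> A \<inter> B = {}"
      and A_null: "\<forall>d :: 'v \<Rightarrow> real. (\<forall>A\<in>\<A>. sum d A = 0) \<longrightarrow> (\<forall>v\<in>E - Z \<inter> E. d v = 0) \<longrightarrow>
        (\<forall>S. P.tight y S \<longrightarrow> sum d S = 0)"
      and A_single: "\<forall>v. {v} \<in> \<A> \<longrightarrow> (\<exists>S T. P.tight y S \<and> P.tight y T \<and>
        y v = p * real (rank_in M S) - p * real (rank_in M T))"
      by (rule P.tight_classes[OF yM Int_lower2 y_off_E])
    obtain \<B> where B: "finite \<B>" "\<forall>A\<in>\<B>. A \<subseteq> Z \<inter> F" "{} \<notin> \<B>"
      "\<forall>A\<in>\<B>. \<forall>B\<in>\<B>. A \<noteq> B \<longrightarrow> A \<inter> B = {}"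
      and B_null: "\<forall>d :: 'v \<Rightarrow> real. (\<forall>A\<in>\<B>. sum d A = 0) \<longrightarrow> (\<forall>v\<in>F - Z \<inter> F. d v = 0) \<longrightarrow>
        (\<forall>S. Q.tight y S \<longrightarrow> sum d S = 0)"
      and B_single: "\<forall>v. {v} \<in> \<B> \<longrightarrow> (\<exists>S T. Q.tight y S \<and> Q.tight y T \<and>
        y v = q * real (rank_in N S) - q * real (rank_in N T))"
      by (rule Q.tight_classes[OF yN Int_lower2 y_off_F])
    note A = A[rule_format] and A_null = A_null[rule_format] and A_single = A_single[rule_format]
    note B = B[rule_format] and B_null = B_null[rule_format] and B_single = B_single[rule_format]
    have contra: False
      if "\<exists>v\<in>Z. d v \<noteq> 0" "\<And>v. v \<notin> Z \<Longrightarrow> d v = 0" "\<And>A. A \<in> \<A> \<union> \<B> \<Longrightarrow> sum d A = 0"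
      for d :: "'v \<Rightarrow> real"
    proof (rule no_null[of d])
      fix S assume S: "P.tight y S"
      show "sum d S = 0"
      proof (rule A_null[OF _ _ S])
        show "sum d A = 0" if "A \<in> \<A>" for A
          by (rule \<open>\<And>A. A \<in> \<A> \<union> \<B> \<Longrightarrow> sum d A = 0\<close>[OF UnI1[OF that]])
        show "d v = 0" if "v \<in> E - Z \<inter> E" for v
          by (rule \<open>\<And>v. v \<notin> Z \<Longrightarrow> d v = 0\<close>) (use that in auto)
      qed
    next
      fix S assume S: "Q.tight y S"
      show "sum d S = 0"
      proof (rule B_null[OF _ _ S])
        show "sum d A = 0" if "A \<in> \<B>" for A
          by (rule \<open>\<And>A. A \<in> \<A> \<union> \<B> \<Longrightarrow> sum d A = 0\<close>[OF UnI2[OF that]])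
        show "d v = 0" if "v \<in> F - Z \<inter> F" for v
          by (rule \<open>\<And>v. v \<notin> Z \<Longrightarrow> d v = 0\<close>) (use that in auto)
      qed
    qed (rule that(2), assumption, rule that(1))
    have pos: "0 < y v" if "v \<in> E \<inter> F" for v
      using y0[of v] no(1)[OF that] that by (auto simp: U_def order_less_le)
    \<comment> \<open>A singleton class would be a leaf and force \<open>y v = p\<close>, one of the
      excluded values.\<close>
    have A_ns: "{v} \<notin> \<A>" if "v \<in> E \<inter> F" for v
      using A_single[of v] M.singleton_class_full[OF pq(1) yM _ pos[OF that]] no(2)[OF that] that by blast
    have B_ns: "{v} \<notin> \<B>" if "v \<in> E \<inter> F" for v
      using B_single[of v] N.singleton_class_full[OF pq(2) yN _ pos[OF that]] no(3)[OF that] that by blast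
    define wt where "wt = (\<lambda>v. if v \<in> E \<inter> F then 1 / 2 else (1 :: real))"
    have cA: "real (card \<A>) \<le> sum wt (Z \<inter> E)"
      "real (card \<A>) = sum wt (Z \<inter> E) \<Longrightarrow> \<Union>{A \<in> \<A>. A \<subseteq> E \<inter> F} = E \<inter> F"
      using class_count[of "Z \<inter> E" "E \<inter> F" \<A>, OF _ _ A A_ns] finZ WZ unfolding wt_def by auto
    have cB: "real (card \<B>) \<le> sum wt (Z \<inter> F)"
      "real (card \<B>) = sum wt (Z \<inter> F) \<Longrightarrow> \<Union>{A \<in> \<B>. A \<subseteq> E \<inter> F} = E \<inter> F"
      using class_count[of "Z \<inter> F" "E \<inter> F" \<B>, OF _ _ B B_ns] finZ WZ unfolding wt_def by auto
    have wt_total: "sum wt (Z \<inter> E) + sum wt (Z \<inter> F) = real (card Z)"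
    proof -
      have "sum wt (Z \<inter> E) + sum wt (Z \<inter> F) =
          (\<Sum>v\<in>Z. (if v \<in> E then wt v else 0) + (if v \<in> F then wt v else 0))"
        by (simp add: sum.distrib sum.inter_restrict[OF finZ])
      also have "\<dots> = (\<Sum>v\<in>Z. 1)"
        by (rule sum.cong) (auto simp: wt_def Z_def U_def)
      finally show ?thesis by simp
    qed
    show False
    proof (cases "card \<A> + card \<B> < card Z")
      case True
      \<comment> \<open>One equation per class, one unknown per element of the support: there are
        fewer equations than unknowns.\<close>
      then have "card (\<A> \<union> \<B>) < card Z" using card_Un_le[of \<A> \<B>] by simp
      from homogeneous_system_nontrivial[of "\<A> \<union> \<B>" Z indicator, OF _ finZ this] A(1) B(1)
      obtain d :: "'v \<Rightarrow> real" where d: "\<exists>v\<in>Z. d v \<noteq> 0" "\<And>v. v \<notin> Z \<Longrightarrow> d v = 0"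
        "\<And>A. A \<in> \<A> \<union> \<B> \<Longrightarrow> (\<Sum>v\<in>Z. indicator A v * d v) = 0" by auto
      have null: "sum d A = 0" if "A \<in> \<A> \<union> \<B>" for A
        using d(3)[OF that] sum_indicator_mult_subset[OF finZ, of A d] A(2) B(2) that by auto
      show False
        by (rule contra[OF d(1,2) null])
    next
      case False
      with cA(1) cB(1) wt_total have "real (card \<A>) = sum wt (Z \<inter> E)" "real (card \<B>) = sum wt (Z \<inter> F)"
        and card_eq: "card \<A> + card \<B> = card Z" by linarith+
      with cA(2) cB(2) have cov: "\<Union>{A \<in> \<A>. A \<subseteq> E \<inter> F} = E \<inter> F" "\<Union>{A \<in> \<B>. A \<subseteq> E \<inter> F} = E \<inter> F"
        by auto
      \<comment> \<open>In the case of equality both families contain a partition of E \<inter> F,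
        so the class equations are dependent. The one for \<open>A0\<close> is dropped to make room
        for a nonzero solution and is recovered afterwards.\<close>
      with W obtain A0 where A0: "A0 \<in> \<A>" "A0 \<subseteq> E \<inter> F" by blast
      have "card ((\<A> - {A0}) \<union> \<B>) < card Z"
        using card_Un_le[of "\<A> - {A0}" \<B>] card_Diff1_less[OF A(1) A0(1)] card_eq by simp
      from homogeneous_system_nontrivial[of "(\<A> - {A0}) \<union> \<B>" Z indicator, OF _ finZ this] A(1) B(1)
      obtain d :: "'v \<Rightarrow> real" where d: "\<exists>v\<in>Z. d v \<noteq> 0" "\<And>v. v \<notin> Z \<Longrightarrow> d v = 0"
        "\<And>A. A \<in> (\<A> - {A0}) \<union> \<B> \<Longrightarrow> (\<Sum>v\<in>Z. indicator A v * d v) = 0" by auto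
      have null: "sum d A = 0" if "A \<in> (\<A> - {A0}) \<union> \<B>" for A
        using d(3)[OF that] sum_indicator_mult_subset[OF finZ, of A d] A(2) B(2) that by auto
      have part: "sum d (E \<inter> F) = (\<Sum>A | A \<in> \<C> \<and> A \<subseteq> E \<inter> F. sum d A)"
        if "\<Union>{A \<in> \<C>. A \<subseteq> E \<inter> F} = E \<inter> F" "\<And>A B. A \<in> \<C> \<Longrightarrow> B \<in> \<C> \<Longrightarrow> A \<noteq> B \<Longrightarrow> A \<inter> B = {}" for \<C>
        using sum.Union_disjoint[of "{A \<in> \<C>. A \<subseteq> E \<inter> F}" d] that
          finite_subset[OF _ finite_subset[OF WZ finZ]] by auto
      have "(\<Sum>A | A \<in> \<B> \<and> A \<subseteq> E \<inter> F. sum d A) = 0"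
        by (rule sum.neutral) (use null in blast)
      then have "sum d (E \<inter> F) = 0" using part[OF cov(2) B(4)] by simp
      \<comment> \<open>The equations of \<open>\<B>\<close> have made the sum over E \<inter> F
        vanish; the classes of \<open>\<A>\<close> inside E \<inter> F other than \<open>A0\<close>
        contribute nothing to it.\<close>
      moreover have "sum d (E \<inter> F) = sum d A0"
      proof -
        have "(\<Sum>A | A \<in> \<A> \<and> A \<subseteq> E \<inter> F. sum d A) = (\<Sum>A\<in>{A0}. sum d A)"
          by (rule sum.mono_neutral_right) (use A(1) A0 null in auto)
        then show ?thesis using part[OF cov(1) A(4)] by simp
      qed
      ultimately have "sum d A0 = 0" by simp
      with null have "sum d A = 0" if "A \<in> \<A> \<union> \<B>" for A
        using that by (cases "A = A0") auto
      from contra[OF d(1,2) this] show False .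
    qed
  qed
  then obtain v where v: "v \<in> E \<inter> F" "y v = 0 \<or> y v = p \<or> y v = q" by blast
  show ?thesis
    by (rule that[OF y0[unfolded U_def] yM yN y_total[unfolded U_def] v])
qed

section \<open>Deletion, contraction and homology\<close>

lemma delete_elt_Pow: "C \<subseteq> Pow V \<Longrightarrow> delete_elt v C \<subseteq> Pow V"
  by (auto simp: delete_elt_def)

lemma add_cone_delete_contract: "add_cone v (delete_elt v C) (contract_elt v C) = C"
proof (intro Set.set_eqI iffI)
  fix A assume "A \<in> add_cone v (delete_elt v C) (contract_elt v C)"
  then show "A \<in> C" by (auto simp: add_cone_def delete_elt_def contract_elt_def)
next
  fix A assume A: "A \<in> C"
  show "A \<in> add_cone v (delete_elt v C) (contract_elt v C)"
  proof (cases "v \<in> A")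
    case True
    then have eq: "insert v (A - {v}) = A" by (rule insert_Diff)
    with A have "A - {v} \<in> contract_elt v C" by (simp add: contract_elt_def)
    then have "insert v (A - {v}) \<in> insert v ` contract_elt v C" by (rule imageI)
    then show ?thesis unfolding eq by (simp add: add_cone_def)
  qed (use A in \<open>simp add: add_cone_def delete_elt_def\<close>)
qed

lemma down_closed_delete: "down_closed C \<Longrightarrow> down_closed (delete_elt v C)"
  unfolding down_closed_def delete_elt_def by blast

lemma contract_subset_delete: "down_closed C \<Longrightarrow> contract_elt v C \<subseteq> delete_elt v C"
  unfolding down_closed_def delete_elt_def contract_elt_def by blast

lemma down_closed_contract:
  assumes "down_closed C" shows "down_closed (contract_elt v C)"
  unfolding down_closed_def
proof (intro ballI allI impI)
  fix A B assume "A \<in> contract_elt v C" "B \<subseteq> A"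
  then have "insert v A \<in> C" "insert v B \<subseteq> insert v A" "v \<notin> B"
    by (auto simp: contract_elt_def)
  then show "B \<in> contract_elt v C"
    using assms unfolding down_closed_def contract_elt_def by blast
qed

lemma vertex_addition_delete_contract:
  assumes "finite V" "v \<in> V" "C \<subseteq> Pow V" "down_closed C"
  shows "vertex_addition V v (delete_elt v C) (contract_elt v C)"
proof
  show "contract_elt v C \<subseteq> delete_elt v C" by (rule contract_subset_delete[OF assms(4)])
  show "down_closed (contract_elt v C)" by (rule down_closed_contract[OF assms(4)])
  show "down_closed (delete_elt v C)" by (rule down_closed_delete[OF assms(4)])
  show "delete_elt v C \<subseteq> Pow V" by (rule delete_elt_Pow[OF assms(3)])
  show "\<forall>A\<in>delete_elt v C. v \<notin> A" by (simp add: delete_elt_def)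
qed (use assms in auto)

lemma acyclic_at_iff_rel:
  assumes "finite V" "v \<in> V" "C \<subseteq> Pow V" "down_closed C"
  shows "acyclic_at TYPE('r::ring_1) C d \<longleftrightarrow> rel_acyclic_at TYPE('r) (delete_elt v C) (contract_elt v C) d"
proof -
  interpret vertex_addition V v "delete_elt v C" "contract_elt v C"
    by (rule vertex_addition_delete_contract[OF assms])
  show ?thesis
    using acyclic_at_add_coneI acyclic_at_add_coneD unfolding add_cone_delete_contract by blast
qed

lemma acyclic_at_delete_contract:
  assumes "finite V" "v \<in> V" "C \<subseteq> Pow V" "down_closed C"
    "acyclic_at TYPE('r::ring_1) (delete_elt v C) d" "acyclic_at TYPE('r) (contract_elt v C) (d - 1)"
  shows "acyclic_at TYPE('r) C d"
  unfolding acyclic_at_iff_rel[OF assms(1-4)]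
  by (rule rel_acyclic_at_of_acyclic[OF assms(5,6,1) delete_elt_Pow[OF assms(3)]
        contract_subset_delete[OF assms(4)] down_closed_delete[OF assms(4)]])

text \<open>Link and deletion agree, so C is a cone with apex \<open>v\<close>, and the pair that
  computes its homology is a complex relative to itself.\<close>

lemma acyclic_at_cone:
  assumes "finite V" "v \<in> V" "C \<subseteq> Pow V" "down_closed C" "contract_elt v C = delete_elt v C"
  shows "acyclic_at TYPE('r::ring_1) C d"
  unfolding acyclic_at_iff_rel[OF assms(1-4)] assms(5) by (rule rel_acyclic_at_refl)

text \<open>The middle complex is \<open>delete_elt v C1\<close>. \<open>C1\<close> and
  \<open>C2\<close> arise by adding \<open>v\<close> to the two pairs of the triple, so the relative
  groups reappear as absolute homology and an induction can stay with absolute statements.\<close>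

lemma acyclic_at_interpolate:
  assumes V: "finite V" "v \<in> V" and C: "C \<subseteq> Pow V" "down_closed C"
    and C1: "C1 \<subseteq> Pow V" "down_closed C1" and C2: "C2 \<subseteq> Pow V" "down_closed C2"
    and eqs: "delete_elt v C2 = delete_elt v C" "contract_elt v C2 = delete_elt v C1"
      "contract_elt v C1 = contract_elt v C"
    and acyc: "acyclic_at TYPE('r::ring_1) C1 d" "acyclic_at TYPE('r) C2 d"
  shows "acyclic_at TYPE('r) C d"
proof -
  have r1: "rel_acyclic_at TYPE('r) (delete_elt v C1) (contract_elt v C) d"
    using acyc(1) unfolding acyclic_at_iff_rel[OF V C1] eqs .
  have r2: "rel_acyclic_at TYPE('r) (delete_elt v C) (delete_elt v C1) d"
    using acyc(2) unfolding acyclic_at_iff_rel[OF V C2] eqs .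
  have "delete_elt v C1 \<subseteq> delete_elt v C"
    using contract_subset_delete[OF C2(2), of v] unfolding eqs .
  moreover have "contract_elt v C \<subseteq> delete_elt v C1"
    using contract_subset_delete[OF C1(2), of v] unfolding eqs .
  ultimately show ?thesis
    unfolding acyclic_at_iff_rel[OF V C]
    by (rule rel_acyclic_at_trans[OF r2 r1 V(1) delete_elt_Pow[OF C(1)] _ _ down_closed_delete[OF C(2)]])
qed

lemma acyclic_at_below:
  assumes "d + 1 < 0" shows "acyclic_at TYPE('r::ring_1) C d"
  unfolding acyclic_at_def
proof
  fix c :: "_ \<Rightarrow> 'r" assume "c \<in> simplicial_cycles C d"
  then have c: "c \<in> simplicial_chains C d" by (simp add: simplicial_cycles_def)
  have "c = (\<lambda>_. 0)"
    using simplicial_chainsD(3)[OF c] assms by force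
  then show "c \<in> simplicial_boundaries C d"
    unfolding simplicial_boundaries_def
    by (intro image_eqI[of _ _ "\<lambda>_. 0"]) (simp_all add: simplicial_boundary_zero simplicial_chains_zero)
qed

lemma (in finite_matroid) down_closed_M: "down_closed M"
  unfolding down_closed_def using M_down by blast

text \<open>Pick \<open>v\<close> in \<open>B\<close>. If some independent set of at least the size
  of \<open>B\<close> avoids \<open>v\<close>, the deletion keeps the bound, the contraction
  contains B - v, and the exact sequence applies. Otherwise \<open>v\<close> is a coloop and the
  complex is a cone.\<close>

lemma acyclic_at_matroid:
  assumes "finite_matroid E M" "B \<in> M" "d + 1 < int (card B)"
  shows "acyclic_at TYPE('r::ring_1) M d"
  using assms
proof (induction "card E" arbitrary: E M B d rule: less_induct)
  case less
  interpret finite_matroid E M by (rule less.prems(1))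
  show ?case
  proof (cases "d + 1 < 0")
    case True
    then show ?thesis by (rule acyclic_at_below)
  next
    case False
    with less.prems obtain v where v: "v \<in> B" by fastforce
    then have vM: "{v} \<in> M" using M_down[OF less.prems(2)] by auto
    have vE: "v \<in> E" using v M_Pow less.prems(2) by auto
    have smaller: "card (E - {v}) < card E" by (rule card_Diff1_less[OF finite_E vE])
    have del: "finite_matroid (E - {v}) (delete_elt v M)"
      using matroid_delete[OF matroid] finite_E by unfold_locales auto
    have con: "finite_matroid (E - {v}) (contract_elt v M)"
      using matroid_contract[OF matroid finite_E vM] finite_E by unfold_locales auto
    show ?thesis
    proof (cases "\<exists>B'\<in>M. v \<notin> B' \<and> card B \<le> card B'")
      case True
      then obtain B' where B': "B' \<in> delete_elt v M" "card B \<le> card B'" by (auto simp: delete_elt_def)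
      have "B - {v} \<in> contract_elt v M"
        using v less.prems(2) by (simp add: contract_elt_def insert_absorb)
      moreover have "d - 1 + 1 < int (card (B - {v}))"
        using less.prems(3) v finite_indep[OF less.prems(2)] card_Suc_Diff1[of B v] by simp
      ultimately have "acyclic_at TYPE('r) (contract_elt v M) (d - 1)"
        by (rule less.hyps[OF smaller con])
      moreover have "acyclic_at TYPE('r) (delete_elt v M) d"
        by (rule less.hyps[OF smaller del B'(1)]) (use less.prems(3) B'(2) in simp)
      ultimately show ?thesis
        by (intro acyclic_at_delete_contract[OF finite_E vE M_Pow down_closed_M])
    next
      case no: False
      \<comment> \<open>A basis containing \<open>A\<close> has at least as many elements as
        \<open>B\<close>, hence contains \<open>v\<close>.\<close>
      have "insert v A \<in> M" if A: "A \<in> M" for A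
      proof -
        have "A \<subseteq> E" using A M_Pow by blast
        then obtain K where K: "K \<in> M" "A \<subseteq> K" "card K = rank_in M E"
          using extend_basis[OF A] by blast
        have "card B \<le> card K" using card_le_rank[OF less.prems(2)] M_Pow less.prems(2) K(3) by auto
        with no K(1) have "v \<in> K" by blast
        then show ?thesis using M_down[OF K(1), of "insert v A"] K(2) by blast
      qed
      then have "contract_elt v M = delete_elt v M"
        using contract_subset_delete[OF down_closed_M, of v] by (auto simp: delete_elt_def contract_elt_def)
      then show ?thesis by (rule acyclic_at_cone[OF finite_E vE M_Pow down_closed_M])
    qed
  qed
qed

section \<open>Matroids on overlapping ground sets\<close>

text \<open>It interpolates between the intersection of two matroids, for equal ground sets, and
  their direct sum, for disjoint ones.\<close>

definition common_indep :: "'v set \<Rightarrow> 'v set set \<Rightarrow> 'v set \<Rightarrow> 'v set set \<Rightarrow> 'v set set" where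
  "common_indep E M F N = {A. A \<subseteq> E \<union> F \<and> A \<inter> E \<in> M \<and> A \<inter> F \<in> N}"

lemma common_indep_swap: "common_indep E M F N = common_indep F N E M"
  unfolding common_indep_def by auto

lemma delete_common_indep:
  "delete_elt v (common_indep E M F N) = common_indep (E - {v}) (delete_elt v M) (F - {v}) (delete_elt v N)"
proof (rule Set.set_eqI)
  fix A
  show "A \<in> delete_elt v (common_indep E M F N) \<longleftrightarrow>
      A \<in> common_indep (E - {v}) (delete_elt v M) (F - {v}) (delete_elt v N)"
  proof (cases "v \<in> A")
    case False
    then have "A \<inter> (E - {v}) = A \<inter> E" "A \<inter> (F - {v}) = A \<inter> F" by auto
    with False show ?thesis by (auto simp: delete_elt_def common_indep_def)
  qed (auto simp: delete_elt_def common_indep_def)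
qed

lemma contract_common_indep:
  assumes "v \<in> E" "v \<in> F"
  shows "contract_elt v (common_indep E M F N) =
    common_indep (E - {v}) (contract_elt v M) (F - {v}) (contract_elt v N)"
proof (rule Set.set_eqI)
  fix A
  show "A \<in> contract_elt v (common_indep E M F N) \<longleftrightarrow>
      A \<in> common_indep (E - {v}) (contract_elt v M) (F - {v}) (contract_elt v N)"
  proof (cases "v \<in> A")
    case False
    then have "A \<inter> (E - {v}) = A \<inter> E" "A \<inter> (F - {v}) = A \<inter> F"
      "insert v A \<inter> E = insert v (A \<inter> E)" "insert v A \<inter> F = insert v (A \<inter> F)" using assms by auto
    with False assms show ?thesis by (auto simp: contract_elt_def common_indep_def)
  qed (auto simp: contract_elt_def common_indep_def)
qed

lemma contract_common_indep_left:
  assumes "v \<in> E" "v \<notin> F" "\<forall>A\<in>N. v \<notin> A"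
  shows "contract_elt v (common_indep E M F N) = common_indep (E - {v}) (contract_elt v M) F N"
proof (rule Set.set_eqI)
  fix A
  show "A \<in> contract_elt v (common_indep E M F N) \<longleftrightarrow> A \<in> common_indep (E - {v}) (contract_elt v M) F N"
  proof (cases "v \<in> A")
    case False
    then have "A \<inter> (E - {v}) = A \<inter> E"
      "insert v A \<inter> E = insert v (A \<inter> E)" "insert v A \<inter> F = A \<inter> F" using assms by auto
    with False assms show ?thesis by (auto simp: contract_elt_def common_indep_def)
  qed (use assms in \<open>auto simp: contract_elt_def common_indep_def\<close>)
qed

lemma delete_elt_ident: "\<forall>A\<in>M. v \<notin> A \<Longrightarrow> delete_elt v M = M"
  by (auto simp: delete_elt_def)

lemma finite_matroid_delete: "finite_matroid E M \<Longrightarrow> finite_matroid (E - {v}) (delete_elt v M)"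
  by (simp add: finite_matroid_def matroid_delete)

lemma finite_matroid_contract: "finite_matroid E M \<Longrightarrow> {v} \<in> M \<Longrightarrow> finite_matroid (E - {v}) (contract_elt v M)"
  by (simp add: finite_matroid_def matroid_contract)

locale two_matroids = M: finite_matroid E M + N: finite_matroid F N
  for E F :: "'v set" and M N :: "'v set set"
begin

lemma common_indep_Pow: "common_indep E M F N \<subseteq> Pow (E \<union> F)"
  by (auto simp: common_indep_def)

lemma common_indep_down: "down_closed (common_indep E M F N)"
  unfolding down_closed_def
proof (intro ballI allI impI)
  fix A B assume A: "A \<in> common_indep E M F N" and B: "B \<subseteq> A"
  then have "A \<inter> E \<in> M" "A \<inter> F \<in> N" "A \<subseteq> E \<union> F" by (auto simp: common_indep_def)
  moreover from this have "B \<inter> E \<in> M" "B \<inter> F \<in> N"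
    using B M.M_down[of "A \<inter> E" "B \<inter> E"] N.M_down[of "A \<inter> F" "B \<inter> F"] by blast+
  ultimately show "B \<in> common_indep E M F N" using B by (auto simp: common_indep_def)
qed

lemma finite_ground: "finite (E \<union> F)"
  using M.finite_E N.finite_E by simp

text \<open>A direct sum: of two sets of different size the smaller one has fewer elements already
  in E or in F, and augmentation there does not affect the other part.\<close>

lemma common_indep_matroid:
  assumes disj: "E \<inter> F = {}"
  shows "matroid (E \<union> F) (common_indep E M F N)"
  unfolding matroid_def
proof (intro conjI ballI allI impI)
  show "common_indep E M F N \<subseteq> Pow (E \<union> F)" by (rule common_indep_Pow)
  show "common_indep E M F N \<noteq> {}"
    using M.M_empty N.M_empty by (auto simp: common_indep_def intro!: exI[of _ "{}"])
  show "B \<in> common_indep E M F N" if "A \<in> common_indep E M F N" "B \<subseteq> A" for A B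
    using that common_indep_down unfolding down_closed_def by blast
  fix A B assume A: "A \<in> common_indep E M F N" and B: "B \<in> common_indep E M F N" and c: "card A < card B"
  have split: "card X = card (X \<inter> E) + card (X \<inter> F)" if "X \<in> common_indep E M F N" for X
  proof -
    have "X = (X \<inter> E) \<union> (X \<inter> F)" using that by (auto simp: common_indep_def)
    moreover have "card ((X \<inter> E) \<union> (X \<inter> F)) = card (X \<inter> E) + card (X \<inter> F)"
      by (rule card_Un_disjoint) (use M.finite_E N.finite_E disj in auto)
    ultimately show ?thesis by simp
  qed
  have AB: "A \<inter> E \<in> M" "A \<inter> F \<in> N" "B \<inter> E \<in> M" "B \<inter> F \<in> N" "A \<subseteq> E \<union> F"
    using A B by (auto simp: common_indep_def)
  from c have "card (A \<inter> E) < card (B \<inter> E) \<or> card (A \<inter> F) < card (B \<inter> F)"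
    unfolding split[OF A] split[OF B] by linarith
  then show "\<exists>x\<in>B - A. insert x A \<in> common_indep E M F N"
  proof
    assume "card (A \<inter> E) < card (B \<inter> E)"
    then obtain x where x: "x \<in> B \<inter> E - A \<inter> E" "insert x (A \<inter> E) \<in> M"
      using M.M_augment[OF AB(1,3)] by blast
    then have "insert x A \<inter> E = insert x (A \<inter> E)" "insert x A \<inter> F = A \<inter> F" using disj by auto
    with x AB show ?thesis by (intro bexI[of _ x]) (auto simp: common_indep_def)
  next
    assume "card (A \<inter> F) < card (B \<inter> F)"
    then obtain x where x: "x \<in> B \<inter> F - A \<inter> F" "insert x (A \<inter> F) \<in> N"
      using N.M_augment[OF AB(2,4)] by blast
    then have "insert x A \<inter> F = insert x (A \<inter> F)" "insert x A \<inter> E = A \<inter> E" using disj by auto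
    with x AB show ?thesis by (intro bexI[of _ x]) (auto simp: common_indep_def)
  qed
qed

lemma acyclic_at_disjoint:
  assumes disj: "E \<inter> F = {}" and d: "d + 1 < int (rank_in M E + rank_in N F)"
  shows "acyclic_at TYPE('r::ring_1) (common_indep E M F N) d"
proof -
  obtain A where A: "A \<in> M" "A \<subseteq> E" "card A = rank_in M E" by (rule M.rank_basis)
  obtain B where B: "B \<in> N" "B \<subseteq> F" "card B = rank_in N F" by (rule N.rank_basis)
  have "(A \<union> B) \<inter> E = A" "(A \<union> B) \<inter> F = B" using A B disj by auto
  then have "A \<union> B \<in> common_indep E M F N" using A B by (auto simp: common_indep_def)
  moreover have "card (A \<union> B) = rank_in M E + rank_in N F"
    using card_Un_disjoint[of A B] A B disj M.finite_indep N.finite_indep by (metis Int_mono subset_empty)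
  ultimately show ?thesis
    using acyclic_at_matroid[of "E \<union> F" "common_indep E M F N" "A \<union> B" d] d finite_ground
      common_indep_matroid[OF disj] by (simp add: finite_matroid_def)
qed

text \<open>Contracting \<open>v\<close> in M and then in N gives the link of \<open>v\<close>;
  contracting in M and deleting in N gives the middle complex. In either auxiliary pair only one
  matroid still has \<open>v\<close>, so only that matroid changes when \<open>v\<close> is deleted
  or contracted.\<close>

lemma acyclic_at_interpolate_common:
  assumes v: "v \<in> E" "v \<in> F" and vM: "{v} \<in> M"
    and acyc: "acyclic_at TYPE('r::ring_1) (common_indep (E - {v}) (contract_elt v M) F N) d"
      "acyclic_at TYPE('r) (common_indep E M (F - {v}) (delete_elt v N)) d"
  shows "acyclic_at TYPE('r) (common_indep E M F N) d"
proof -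
  have fm: "finite_matroid E M" "finite_matroid F N" by unfold_locales
  interpret C1: two_matroids "E - {v}" F "contract_elt v M" N
    using finite_matroid_contract[OF fm(1) vM] fm(2) by (simp add: two_matroids_def)
  interpret C2: two_matroids E "F - {v}" M "delete_elt v N"
    using finite_matroid_delete[OF fm(2)] fm(1) by (simp add: two_matroids_def)
  have no_v: "\<forall>A\<in>delete_elt v N. v \<notin> A" "\<forall>A\<in>contract_elt v M. v \<notin> A"
    by (auto simp: delete_elt_def contract_elt_def)
  show ?thesis
  proof (rule acyclic_at_interpolate[OF finite_ground, of v])
    show "v \<in> E \<union> F" using v by simp
    show "common_indep E M F N \<subseteq> Pow (E \<union> F)" by (rule common_indep_Pow)
    show "down_closed (common_indep E M F N)" by (rule common_indep_down)
    show "common_indep (E - {v}) (contract_elt v M) F N \<subseteq> Pow (E \<union> F)"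
      using C1.common_indep_Pow by blast
    show "down_closed (common_indep (E - {v}) (contract_elt v M) F N)" by (rule C1.common_indep_down)
    show "common_indep E M (F - {v}) (delete_elt v N) \<subseteq> Pow (E \<union> F)"
      using C2.common_indep_Pow by blast
    show "down_closed (common_indep E M (F - {v}) (delete_elt v N))" by (rule C2.common_indep_down)
    show "delete_elt v (common_indep E M (F - {v}) (delete_elt v N)) = delete_elt v (common_indep E M F N)"
      unfolding delete_common_indep delete_elt_ident[OF no_v(1)] by simp
    show "contract_elt v (common_indep E M (F - {v}) (delete_elt v N)) =
        delete_elt v (common_indep (E - {v}) (contract_elt v M) F N)"
      unfolding delete_common_indep delete_elt_ident[OF no_v(2)]
      using contract_common_indep_left[OF v(1) _ no_v(1), of "F - {v}"] by simp
    show "contract_elt v (common_indep (E - {v}) (contract_elt v M) F N) = contract_elt v (common_indep E M F N)"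
      unfolding contract_common_indep[OF v] common_indep_swap[of "E - {v}" "contract_elt v M"]
      using contract_common_indep_left[OF v(2) _ no_v(2), of "E - {v}"] by simp
  qed (use acyc in auto)
qed

end

section \<open>The main induction\<close>

lemma (in finite_matroid) rank_feasibleD:
  "0 \<le> c \<Longrightarrow> rank_feasible c E M x \<Longrightarrow> S \<subseteq> E \<Longrightarrow> sum x S \<le> c * real (rank_in M S)"
  using rank_feasible_iff by blast

lemma (in finite_matroid) rank_feasible_mono:
  assumes "0 \<le> c" "rank_feasible c E M x" "\<And>v. v \<in> E \<Longrightarrow> y v \<le> x v"
  shows "rank_feasible c E M y"
  unfolding rank_feasible_iff[OF assms(1)]
proof (intro allI impI)
  fix S assume S: "S \<subseteq> E"
  then have "sum y S \<le> sum x S" using assms(3) by (intro sum_mono) auto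
  also have "\<dots> \<le> c * real (rank_in M S)" by (rule rank_feasibleD[OF assms(1,2) S])
  finally show "sum y S \<le> c * real (rank_in M S)" .
qed

lemma (in finite_matroid) rank_feasible_delete:
  assumes "0 \<le> c" "rank_feasible c E M x"
  shows "rank_feasible c (E - {v}) (delete_elt v M) x"
proof -
  interpret D: finite_matroid "E - {v}" "delete_elt v M"
    by (rule finite_matroid_delete) unfold_locales
  show ?thesis
    unfolding D.rank_feasible_iff[OF assms(1)]
  proof (intro allI impI)
    fix S assume S: "S \<subseteq> E - {v}"
    then have "S \<subseteq> E" "v \<notin> S" by auto
    then show "sum x S \<le> c * real (rank_in (delete_elt v M) S)"
      using rank_feasibleD[OF assms] rank_delete by simp
  qed
qed

text \<open>Compare with the bound for \<open>insert v S\<close>: there \<open>v\<close> itself uses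
  up \<open>c\<close>, which is all that the contraction can take off the bound.\<close>

lemma (in finite_matroid) rank_feasible_contract_full:
  assumes "0 \<le> c" "rank_feasible c E M x" "{v} \<in> M" "x v = c"
  shows "rank_feasible c (E - {v}) (contract_elt v M) x"
proof -
  interpret D: finite_matroid "E - {v}" "contract_elt v M"
    by (rule finite_matroid_contract[OF _ assms(3)]) unfold_locales
  show ?thesis
    unfolding D.rank_feasible_iff[OF assms(1)]
  proof (intro allI impI)
    fix S assume S: "S \<subseteq> E - {v}"
    have "v \<in> E" using assms(3) M_Pow by auto
    with S have vS: "insert v S \<subseteq> E" "v \<notin> S" "finite S" using finite_E finite_subset by auto
    have "c + sum x S = sum x (insert v S)" using vS assms(4) by simp
    also have "\<dots> \<le> c * real (rank_in M (insert v S))" by (rule rank_feasibleD[OF assms(1,2) vS(1)])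
    also have "\<dots> \<le> c * real (rank_in (contract_elt v M) S + 1)"
      by (rule mult_left_mono[OF _ assms(1)]) (use rank_contract[OF assms(3) vS(2)] in simp)
    finally show "sum x S \<le> c * real (rank_in (contract_elt v M) S)" by (simp add: distrib_left)
  qed
qed

text \<open>Contraction lowers each rank by at most 1, so each bound is exceeded by at most
  \<open>c\<close>; the greedy reduction repairs this at total cost \<open>c\<close>.\<close>

lemma (in finite_matroid) rank_feasible_contract:
  assumes "0 \<le> c" "rank_feasible c E M x" "{v} \<in> M" "\<And>u. u \<in> E \<Longrightarrow> 0 \<le> x u"
  obtains y where "\<And>u. u \<in> E - {v} \<Longrightarrow> 0 \<le> y u" "\<And>u. y u \<le> x u" "\<And>u. u \<notin> E - {v} \<Longrightarrow> y u = x u"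
    "rank_feasible c (E - {v}) (contract_elt v M) y" "sum x (E - {v}) - c \<le> sum y (E - {v})"
proof -
  interpret D: finite_matroid "E - {v}" "contract_elt v M"
    by (rule finite_matroid_contract[OF _ assms(3)]) unfold_locales
  interpret P: polymatroid_fun "E - {v}" "\<lambda>S. c * real (rank_in (contract_elt v M) S)"
    by (rule D.polymatroid_rank[OF assms(1)])
  show ?thesis
  proof (rule P.reduce_to_feasible[of x c])
    show "0 \<le> x u" if "u \<in> E - {v}" for u using assms(4) that by simp
    show "sum x S \<le> c * real (rank_in (contract_elt v M) S) + c" if S: "S \<subseteq> E - {v}" for S
    proof -
      have "sum x S \<le> c * real (rank_in M S)"
        by (rule rank_feasibleD[OF assms(1,2)]) (use S in auto)
      also have "\<dots> \<le> c * real (rank_in (contract_elt v M) S + 1)"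
      proof (rule mult_left_mono[OF _ assms(1)])
        have "rank_in M S \<le> rank_in M (insert v S)" by (rule rank_mono) auto
        also have "\<dots> \<le> rank_in (contract_elt v M) S + 1"
          by (rule rank_contract[OF assms(3)]) (use S in auto)
        finally show "real (rank_in M S) \<le> real (rank_in (contract_elt v M) S + 1)" by simp
      qed
      finally show ?thesis by (simp add: distrib_left)
    qed
  qed (rule that)
qed

lemma sum_diff_outside:
  fixes x y :: "'v \<Rightarrow> real"
  assumes "finite U" "E \<subseteq> U" "\<And>u. u \<notin> E \<Longrightarrow> y u = x u" "sum x E - c \<le> sum y E"
  shows "sum x U - c \<le> sum y U"
proof -
  have "sum y (U - E) = sum x (U - E)" by (rule sum.cong) (use assms(3) in auto)
  then show ?thesis
    using sum.subset_diff[OF assms(2,1), of x] sum.subset_diff[OF assms(2,1), of y] assms(4) by simp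
qed

text \<open>Reduce for M, then for N. The second reduction only lowers values, so feasibility for M
  survives; each reduction is confined to one ground set, so its loss there is its loss on the
  union.\<close>

lemma (in two_matroids) rank_feasible_contract_both:
  assumes pq: "0 \<le> p" "0 \<le> q" and feas: "rank_feasible p E M x" "rank_feasible q F N x"
    and v: "{v} \<in> M" "{v} \<in> N" and x0: "\<And>u. u \<in> E \<union> F \<Longrightarrow> 0 \<le> x u"
  obtains z where "\<And>u. u \<in> (E - {v}) \<union> (F - {v}) \<Longrightarrow> 0 \<le> z u"
    "rank_feasible p (E - {v}) (contract_elt v M) z" "rank_feasible q (F - {v}) (contract_elt v N) z"
    "sum x ((E - {v}) \<union> (F - {v})) - (p + q) \<le> sum z ((E - {v}) \<union> (F - {v}))"
proof -
  interpret CM: finite_matroid "E - {v}" "contract_elt v M"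
    by (rule finite_matroid_contract[OF _ v(1)]) unfold_locales
  let ?U = "(E - {v}) \<union> (F - {v})"
  have finU: "finite ?U" using finite_ground by auto
  obtain y where y: "\<And>u. u \<in> E - {v} \<Longrightarrow> 0 \<le> y u" "\<And>u. y u \<le> x u" "\<And>u. u \<notin> E - {v} \<Longrightarrow> y u = x u"
    "rank_feasible p (E - {v}) (contract_elt v M) y" "sum x (E - {v}) - p \<le> sum y (E - {v})"
    by (rule M.rank_feasible_contract[OF pq(1) feas(1) v(1) x0]) auto
  have y0: "0 \<le> y u" if "u \<in> E \<union> F" for u
    using y(1)[of u] y(3)[of u] x0[OF that] by (cases "u \<in> E - {v}") auto
  have yN: "rank_feasible q F N y" by (rule N.rank_feasible_mono[OF pq(2) feas(2) y(2)])
  obtain z where z: "\<And>u. u \<in> F - {v} \<Longrightarrow> 0 \<le> z u" "\<And>u. z u \<le> y u" "\<And>u. u \<notin> F - {v} \<Longrightarrow> z u = y u"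
    "rank_feasible q (F - {v}) (contract_elt v N) z" "sum y (F - {v}) - q \<le> sum z (F - {v})"
    by (rule N.rank_feasible_contract[OF pq(2) yN v(2) y0]) auto
  show ?thesis
  proof (rule that[of z])
    show "0 \<le> z u" if "u \<in> ?U" for u
      using z(1)[of u] z(3)[of u] y0[of u] that by (cases "u \<in> F - {v}") auto
    show "rank_feasible p (E - {v}) (contract_elt v M) z"
      by (rule CM.rank_feasible_mono[OF pq(1) y(4) z(2)])
    show "rank_feasible q (F - {v}) (contract_elt v N) z" by (rule z(4))
    show "sum x ?U - (p + q) \<le> sum z ?U"
      using sum_diff_outside[OF finU Un_upper1 y(3,5)] sum_diff_outside[OF finU Un_upper2 z(3,5)] by simp
  qed
qed

lemma two_matroids_iff: "two_matroids E F M N \<longleftrightarrow> finite_matroid E M \<and> finite_matroid F N"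
  by (simp add: two_matroids_def)

text \<open>The induction measure counts shared elements twice, so that it also drops when
  \<open>v\<close> leaves just one of the two ground sets.\<close>

lemma acyclic_at_common_indep:
  fixes p q :: real
  assumes "two_matroids E F M N" "0 < p" "0 < q"
    "\<And>u. u \<in> E \<union> F \<Longrightarrow> 0 \<le> x u" "rank_feasible p E M x" "rank_feasible q F N x"
    "real_of_int (d + 1) * (p + q) < sum x (E \<union> F)"
  shows "acyclic_at TYPE('r::ring_1) (common_indep E M F N) d"
  using assms
proof (induction "card E + card F" arbitrary: E F M N p q x d rule: less_induct)
  case less
  interpret two_matroids E F M N by (rule less.prems(1))
  have fm: "finite_matroid E M" "finite_matroid F N" by unfold_locales
  have pq: "0 \<le> p" "0 \<le> q" using less.prems(2,3) by auto
  show ?case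
  proof (cases "E \<inter> F = {}")
    case True
    have "real_of_int (d + 1) * (p + q) < sum x (E \<union> F)" by (rule less.prems(7))
    also have "\<dots> = sum x E + sum x F"
      by (rule sum.union_disjoint[OF M.finite_E N.finite_E True])
    also have "\<dots> \<le> p * real (rank_in M E) + q * real (rank_in N F)"
      by (intro add_mono M.rank_feasibleD[OF pq(1) less.prems(5)] N.rank_feasibleD[OF pq(2) less.prems(6)]) auto
    \<comment> \<open>A crude estimate is enough: the direct sum is acyclic below r_M(E) + r_N(F),
      and x(E \<union> F) is at most p + q times this.\<close>
    also have "\<dots> \<le> (p + q) * real (rank_in M E) + (p + q) * real (rank_in N F)"
      by (intro add_mono mult_right_mono) (use pq in auto)
    also have "\<dots> = real (rank_in M E + rank_in N F) * (p + q)" by (simp add: algebra_simps)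
    finally have "real_of_int (d + 1) < real (rank_in M E + rank_in N F)"
      using less.prems(2,3) by (simp add: mult_less_cancel_right)
    then have "d + 1 < int (rank_in M E + rank_in N F)" by linarith
    then show ?thesis by (rule acyclic_at_disjoint[OF True])
  next
    case False
    obtain y v where y0: "\<And>u. u \<in> E \<union> F \<Longrightarrow> 0 \<le> y u" and yM: "rank_feasible p E M y"
      and yN: "rank_feasible q F N y" and total: "sum x (E \<union> F) \<le> sum y (E \<union> F)"
      and v: "v \<in> E \<inter> F" and cases: "y v = 0 \<or> y v = p \<or> y v = q"
      by (rule extreme_feasible_leaf[OF fm less.prems(2,3) False less.prems(4-6)]) auto
    have vE: "v \<in> E" "v \<in> F" using v by auto
    have smaller: "card (E - {v}) < card E" "card (F - {v}) < card F"
      using card_Diff1_less[OF M.finite_E vE(1)] card_Diff1_less[OF N.finite_E vE(2)] by auto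
    have bound: "real_of_int (d + 1) * (p + q) < sum y (E \<union> F)"
      using less.prems(7) total by simp
    \<comment> \<open>A loop has value 0, so an element of positive value can be contracted.\<close>
    have vM: "{v} \<in> M" if "y v \<noteq> 0"
    proof (rule ccontr)
      assume "{v} \<notin> M"
      then have "y v \<le> 0"
        using M.rank_feasibleD[OF pq(1) yM, of "{v}"] M.rank_loop[of v] vE by simp
      with y0[of v] vE that show False by auto
    qed
    have vN: "{v} \<in> N" if "y v \<noteq> 0"
    proof (rule ccontr)
      assume "{v} \<notin> N"
      then have "y v \<le> 0"
        using N.rank_feasibleD[OF pq(2) yN, of "{v}"] N.rank_loop[of v] vE by simp
      with y0[of v] vE that show False by auto
    qed
    from cases show ?thesis
    proof (elim disjE)
      assume yv: "y v = 0"
      have U: "(E - {v}) \<union> (F - {v}) = (E \<union> F) - {v}" by auto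
      have sumU: "sum y ((E - {v}) \<union> (F - {v})) = sum y (E \<union> F)"
        unfolding U using sum.remove[OF finite_ground, of v y] vE yv by simp
      have del: "acyclic_at TYPE('r) (delete_elt v (common_indep E M F N)) d"
        unfolding delete_common_indep
      proof (rule less.hyps[of _ _ _ _ p q y])
        show "two_matroids (E - {v}) (F - {v}) (delete_elt v M) (delete_elt v N)"
          using fm by (simp add: two_matroids_iff finite_matroid_delete)
        show "rank_feasible p (E - {v}) (delete_elt v M) y" by (rule M.rank_feasible_delete[OF pq(1) yM])
        show "rank_feasible q (F - {v}) (delete_elt v N) y" by (rule N.rank_feasible_delete[OF pq(2) yN])
        show "real_of_int (d + 1) * (p + q) < sum y ((E - {v}) \<union> (F - {v}))"
          unfolding sumU by (rule bound)
        show "0 \<le> y u" if "u \<in> (E - {v}) \<union> (F - {v})" for u by (rule y0) (use that in auto)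
      qed (use smaller less.prems(2,3) in auto)
      show ?thesis
      proof (cases "{v} \<in> M \<and> {v} \<in> N")
        case True
        then have vMN: "{v} \<in> M" "{v} \<in> N" by auto
        obtain z where z: "\<And>u. u \<in> (E - {v}) \<union> (F - {v}) \<Longrightarrow> 0 \<le> z u"
          "rank_feasible p (E - {v}) (contract_elt v M) z" "rank_feasible q (F - {v}) (contract_elt v N) z"
          "sum y ((E - {v}) \<union> (F - {v})) - (p + q) \<le> sum z ((E - {v}) \<union> (F - {v}))"
          by (rule rank_feasible_contract_both[OF pq yM yN vMN y0]) auto
        have "acyclic_at TYPE('r) (contract_elt v (common_indep E M F N)) (d - 1)"
          unfolding contract_common_indep[OF vE]
        proof (rule less.hyps[of _ _ _ _ p q z])
          show "two_matroids (E - {v}) (F - {v}) (contract_elt v M) (contract_elt v N)"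
            using fm vMN by (simp add: two_matroids_iff finite_matroid_contract)
          \<comment> \<open>The loss of at most p + q is exactly compensated by the lower
            degree.\<close>
          show "real_of_int (d - 1 + 1) * (p + q) < sum z ((E - {v}) \<union> (F - {v}))"
            using z(4) bound unfolding sumU by (simp add: algebra_simps)
        qed (use smaller less.prems(2,3) z in auto)
        with del show ?thesis
          by (intro acyclic_at_delete_contract[OF finite_ground _ common_indep_Pow common_indep_down, of v])
            (use vE in auto)
      next
        case False
        \<comment> \<open>A loop of one matroid is no vertex of the complex, which therefore equals
          its deletion.\<close>
        have "v \<notin> A" if A: "A \<in> common_indep E M F N" for A
        proof
          assume "v \<in> A"
          then have "{v} \<subseteq> A \<inter> E" "{v} \<subseteq> A \<inter> F" using vE by auto
          moreover have "A \<inter> E \<in> M" "A \<inter> F \<in> N" using A by (auto simp: common_indep_def)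
          ultimately show False using False M.M_down N.M_down by blast
        qed
        with del show ?thesis using delete_elt_ident[of "common_indep E M F N" v] by simp
      qed
    next
      assume yv: "y v = p"
      then have vM: "{v} \<in> M" using vM less.prems(2) by auto
      show ?thesis
      proof (rule acyclic_at_interpolate_common[OF vE vM])
        show "acyclic_at TYPE('r) (common_indep (E - {v}) (contract_elt v M) F N) d"
        proof (rule less.hyps[of _ _ _ _ p q y])
          show "two_matroids (E - {v}) F (contract_elt v M) N"
            using fm vM by (simp add: two_matroids_iff finite_matroid_contract)
          show "rank_feasible p (E - {v}) (contract_elt v M) y"
            by (rule M.rank_feasible_contract_full[OF pq(1) yM vM yv])
          \<comment> \<open>\<open>v\<close> survives in F and keeps its value, so the total and the
            degree are unchanged.\<close>
          have "(E - {v}) \<union> F = E \<union> F" using vE by auto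
          then show "real_of_int (d + 1) * (p + q) < sum y ((E - {v}) \<union> F)" using bound by simp
          show "0 \<le> y u" if "u \<in> (E - {v}) \<union> F" for u by (rule y0) (use that in auto)
        qed (use smaller less.prems(2,3) yN in auto)
        show "acyclic_at TYPE('r) (common_indep E M (F - {v}) (delete_elt v N)) d"
        proof (rule less.hyps[of _ _ _ _ p q y])
          show "two_matroids E (F - {v}) M (delete_elt v N)"
            using fm by (simp add: two_matroids_iff finite_matroid_delete)
          show "rank_feasible q (F - {v}) (delete_elt v N) y" by (rule N.rank_feasible_delete[OF pq(2) yN])
          have "E \<union> (F - {v}) = E \<union> F" using vE by auto
          then show "real_of_int (d + 1) * (p + q) < sum y (E \<union> (F - {v}))" using bound by simp
          show "0 \<le> y u" if "u \<in> E \<union> (F - {v})" for u by (rule y0) (use that in auto)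
        qed (use smaller less.prems(2,3) yM in auto)
      qed
    next
      assume yv: "y v = q"
      then have vN: "{v} \<in> N" using vN less.prems(3) by auto
      \<comment> \<open>The roles of the matroids are exchanged for the interpolation only; the
        induction hypothesis is used in the original order.\<close>
      interpret S: two_matroids F E N M using fm by (simp add: two_matroids_iff)
      show ?thesis
        unfolding common_indep_swap[of E M F N]
      proof (rule S.acyclic_at_interpolate_common[OF vE(2,1) vN])
        show "acyclic_at TYPE('r) (common_indep (F - {v}) (contract_elt v N) E M) d"
          unfolding common_indep_swap[of "F - {v}"]
        proof (rule less.hyps[of _ _ _ _ p q y])
          show "two_matroids E (F - {v}) M (contract_elt v N)"
            using fm vN by (simp add: two_matroids_iff finite_matroid_contract)
          show "rank_feasible q (F - {v}) (contract_elt v N) y"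
            by (rule N.rank_feasible_contract_full[OF pq(2) yN vN yv])
          have "E \<union> (F - {v}) = E \<union> F" using vE by auto
          then show "real_of_int (d + 1) * (p + q) < sum y (E \<union> (F - {v}))" using bound by simp
          show "0 \<le> y u" if "u \<in> E \<union> (F - {v})" for u by (rule y0) (use that in auto)
        qed (use smaller less.prems(2,3) yM in auto)
        show "acyclic_at TYPE('r) (common_indep F N (E - {v}) (delete_elt v M)) d"
          unfolding common_indep_swap[of F]
        proof (rule less.hyps[of _ _ _ _ p q y])
          show "two_matroids (E - {v}) F (delete_elt v M) N"
            using fm by (simp add: two_matroids_iff finite_matroid_delete)
          show "rank_feasible p (E - {v}) (delete_elt v M) y" by (rule M.rank_feasible_delete[OF pq(1) yM])
          have "(E - {v}) \<union> F = E \<union> F" using vE by auto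
          then show "real_of_int (d + 1) * (p + q) < sum y ((E - {v}) \<union> F)" using bound by simp
          show "0 \<le> y u" if "u \<in> (E - {v}) \<union> F" for u by (rule y0) (use that in auto)
        qed (use smaller less.prems(2,3) yN in auto)
      qed
    qed
  qed
qed

section \<open>Connectivity\<close>

text \<open>Translating the boundaries by a cycle that is itself a boundary gives them back, so the
  only coset is the unit of the factor group.\<close>

lemma reduced_homology_trivial:
  fixes C :: "'v set set" and d :: int
  assumes V: "finite V" "C \<subseteq> Pow V" and acyc: "acyclic_at TYPE('r::ring_1) C d"
  shows "carrier (reduced_homology C d :: ('v list \<Rightarrow> 'r) set monoid) = {one (reduced_homology C d)}"
proof -
  let ?Z = "simplicial_cycles C d :: ('v list \<Rightarrow> 'r) set"
  let ?B = "simplicial_boundaries C d :: ('v list \<Rightarrow> 'r) set"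
  let ?G = "cycle_group C d :: ('v list \<Rightarrow> 'r) monoid"
  have diff: "(\<lambda>xs. a xs - b xs) \<in> ?B" if "a \<in> ?B" "b \<in> ?B" for a b
  proof -
    obtain a' b' where ab: "a' \<in> simplicial_chains C (d + 1)" "a = simplicial_boundary a'"
      "b' \<in> simplicial_chains C (d + 1)" "b = simplicial_boundary b'"
      using \<open>a \<in> ?B\<close> \<open>b \<in> ?B\<close> unfolding simplicial_boundaries_def by blast
    show ?thesis
      unfolding simplicial_boundaries_def ab(2,4) simplicial_boundary_diff[OF ab(1,3) V, symmetric]
      by (rule imageI[OF simplicial_chains_diff[OF ab(1,3)]])
  qed
  have zero: "(\<lambda>_. 0) \<in> ?B"
    unfolding simplicial_boundaries_def
    by (intro image_eqI[of _ _ "\<lambda>_. 0"]) (simp_all add: simplicial_boundary_zero simplicial_chains_zero)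
  have coset: "?B #>\<^bsub>?G\<^esub> a = ?B" if "a \<in> ?Z" for a
  proof -
    have aB: "a \<in> ?B" using that acyc unfolding acyclic_at_def by blast
    have mult: "h \<otimes>\<^bsub>?G\<^esub> a = (\<lambda>xs. h xs + a xs)" for h by (simp add: cycle_group_def)
    have "?B #>\<^bsub>?G\<^esub> a = (\<lambda>h xs. h xs + a xs) ` ?B"
      unfolding r_coset_def mult by blast
    also have "\<dots> = ?B"
    proof
      show "(\<lambda>h xs. h xs + a xs) ` ?B \<subseteq> ?B"
      proof
        fix c assume "c \<in> (\<lambda>h xs. h xs + a xs) ` ?B"
        then obtain h where h: "h \<in> ?B" "c = (\<lambda>xs. h xs + a xs)" by blast
        have "(\<lambda>xs. h xs - (0 - a xs)) \<in> ?B" by (rule diff[OF h(1) diff[OF zero aB]])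
        then show "c \<in> ?B" using h(2) by simp
      qed
      show "?B \<subseteq> (\<lambda>h xs. h xs + a xs) ` ?B"
      proof
        fix c assume "c \<in> ?B"
        then have "(\<lambda>xs. c xs - a xs) \<in> ?B" by (rule diff[OF _ aB])
        then show "c \<in> (\<lambda>h xs. h xs + a xs) ` ?B" by (rule rev_image_eqI) simp
      qed
    qed
    finally show ?thesis .
  qed
  have "(\<lambda>_. 0) \<in> ?Z"
    by (simp add: simplicial_cycles_def simplicial_chains_zero simplicial_boundary_zero)
  then have "(\<Union>a\<in>?Z. {?B #>\<^bsub>?G\<^esub> a}) = {?B}" using coset by auto
  then show ?thesis
    unfolding reduced_homology_def FactGroup_def RCOSETS_def by (simp add: cycle_group_def)
qed

text \<open>The chain with value 1 on the empty simplex is a cycle of degree -1, and a chain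
  bounding it must be nonzero on some vertex.\<close>

lemma acyclic_at_minus_one_vertex:
  assumes "{} \<in> C" "acyclic_at TYPE('r::ring_1) C (- 1)"
  obtains v where "{v} \<in> C"
proof -
  define c where "c = (\<lambda>xs :: 'a list. if xs = [] then 1 else (0 :: 'r))"
  have "{xs. c xs \<noteq> 0} = {[]}" by (auto simp: c_def)
  then have "c \<in> simplicial_chains C (- 1)"
    unfolding simplicial_chains_expand using assms(1) by (auto simp: c_def split: if_splits)
  moreover have "simplicial_boundary c = (\<lambda>_. 0)"
    by (rule ext) (simp add: simplicial_boundary_def c_def)
  ultimately have "c \<in> simplicial_boundaries C (- 1)"
    using assms(2) unfolding acyclic_at_def simplicial_cycles_def by blast
  then obtain u :: "'a list \<Rightarrow> 'r" where u: "u \<in> simplicial_chains C (- 1 + 1)" "c = simplicial_boundary u"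
    unfolding simplicial_boundaries_def by blast
  have "simplicial_boundary u [] \<noteq> 0" unfolding u(2)[symmetric] by (simp add: c_def)
  then obtain v where "u [v] \<noteq> 0" by (rule simplicial_boundary_nonzeroE)
  from simplicial_chainsD(2)[OF u(1) this] show ?thesis by (intro that) simp
qed

lemma eta_ge:
  fixes C :: "'v set set" and h :: real
  assumes V: "finite V" "C \<subseteq> Pow V" and empty: "{} \<in> C"
    and acyc: "\<And>k. real k < h \<Longrightarrow> acyclic_at TYPE('r::ring_1) C (int k - 1)"
  shows "ereal h \<le> ereal_of_enat (eta TYPE('r) C)"
proof (cases "C \<subseteq> {{}}")
  case True
  \<comment> \<open>Here \<open>eta\<close> is 0 by convention. A positive \<open>h\<close> would
    require acyclicity in degree -1, hence a vertex.\<close>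
  have "h \<le> 0"
  proof (rule ccontr)
    assume "\<not> h \<le> 0"
    then have "acyclic_at TYPE('r) C (- 1)" using acyc[of 0] by simp
    then obtain v where "{v} \<in> C" by (rule acyclic_at_minus_one_vertex[OF empty])
    with True show False by blast
  qed
  then show ?thesis using True by (simp add: eta_def zero_enat_def[symmetric])
next
  case False
  define S where "S = {enat k | k. carrier (reduced_homology C (int k - 1) :: ('v list \<Rightarrow> 'r) set monoid)
    \<noteq> {one (reduced_homology C (int k - 1))}}"
  have eta: "eta TYPE('r) C = Inf S" using False by (simp add: eta_def S_def)
  show ?thesis
  proof (cases "S = {}")
    case True
    then show ?thesis unfolding eta by (simp add: Inf_enat_def)
  next
    case False
    then obtain s where "s \<in> S" by blast
    \<comment> \<open>The infimum of a nonempty set of extended naturals is attained, here at a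
      degree with nonzero homology, which acyclicity below \<open>h\<close> excludes for k <
      h.\<close>
    then have "Inf S \<in> S" by (rule wellorder_InfI)
    then obtain k where k: "Inf S = enat k"
      "carrier (reduced_homology C (int k - 1) :: ('v list \<Rightarrow> 'r) set monoid) \<noteq> {one (reduced_homology C (int k - 1))}"
      unfolding S_def by blast
    have "h \<le> real k"
      using reduced_homology_trivial[OF V acyc[of k]] k(2) by (meson not_le)
    then show ?thesis unfolding eta k(1) by simp
  qed
qed

text \<open>Double counting of incidences: each of the \<open>k\<close> independent sets meets
  \<open>S\<close> in an independent set, of size at most the rank of \<open>S\<close>.\<close>

lemma sum_occ_le:
  assumes "finite_matroid V M" "S \<subseteq> V" "\<And>i. i \<in> {1..k} \<Longrightarrow> A i \<in> M"
  shows "(\<Sum>v\<in>S. occ v k A) \<le> k * rank_in M S"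
proof -
  interpret finite_matroid V M by (rule assms(1))
  have fin: "finite S" using assms(2) finite_E finite_subset by auto
  have "(\<Sum>v\<in>S. occ v k A) = (\<Sum>v\<in>S. \<Sum>i\<in>{1..k}. if v \<in> A i then 1 else 0)"
    by (rule sum.cong[OF refl]) (simp add: occ_def sum.If_cases Int_def)
  also have "\<dots> = (\<Sum>i\<in>{1..k}. \<Sum>v\<in>S. if v \<in> A i then 1 else 0)" by (rule sum.swap)
  also have "\<dots> \<le> (\<Sum>i\<in>{1..k}. rank_in M S)"
  proof (rule sum_mono)
    fix i assume i: "i \<in> {1..k}"
    have "(\<Sum>v\<in>S. if v \<in> A i then 1 else 0) = card (S \<inter> A i)"
      using fin by (simp add: sum.If_cases)
    also have "\<dots> \<le> rank_in M S"
      by (rule card_le_rank[OF M_down[OF assms(3)[OF i]]]) auto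
    finally show "(\<Sum>v\<in>S. if v \<in> A i then 1 else 0) \<le> rank_in M S" .
  qed
  finally show ?thesis by simp
qed

lemma nu_attained:
  assumes "finite V" "matroid V M" "matroid V N"
  obtains A B where "\<And>i. i \<in> {1..p} \<Longrightarrow> A i \<in> M" "\<And>i. i \<in> {1..q} \<Longrightarrow> B i \<in> N"
    "nu p q V M N = (\<Sum>v\<in>V. min (occ v p A) (occ v q B))"
proof -
  let ?X = "({1..p} \<rightarrow>\<^sub>E M) \<times> ({1..q} \<rightarrow>\<^sub>E N)"
  have "finite ?X"
    using matroid_finite[OF assms(1,2)] matroid_finite[OF assms(1,3)] by (auto intro!: finite_PiE)
  moreover have "(\<lambda>i\<in>{1..p}. {}, \<lambda>i\<in>{1..q}. {}) \<in> ?X"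
    using matroidD(2)[OF assms(2)] matroidD(2)[OF assms(3)] by auto
  then have "?X \<noteq> {}" by blast
  ultimately have "nu p q V M N \<in> (\<lambda>(A, B). \<Sum>v\<in>V. min (occ v p A) (occ v q B)) ` ?X"
    unfolding nu_def by (intro Max_in) simp_all
  then obtain A B where "A \<in> {1..p} \<rightarrow>\<^sub>E M" "B \<in> {1..q} \<rightarrow>\<^sub>E N"
    "nu p q V M N = (\<Sum>v\<in>V. min (occ v p A) (occ v q B))" by auto
  then show ?thesis by (intro that[of A B]) (auto dest: PiE_mem)
qed

theorem theorem5p1:
  fixes p q :: nat and V :: "'v set" and \<M> \<N> :: "'v set set"
  assumes "p \<ge> 1" and "q \<ge> 1"
    and "finite V" and "matroid V \<M>" and "matroid V \<N>"
  shows "ereal_of_enat (eta TYPE('r::ring_1) (\<M> \<inter> \<N>))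
           \<ge> ereal (real (nu p q V \<M> \<N>) / real (p + q))"
proof -
  have fm: "finite_matroid V \<M>" "finite_matroid V \<N>" using assms by (simp_all add: finite_matroid_def)
  interpret M: finite_matroid V \<M> by (rule fm)
  interpret N: finite_matroid V \<N> by (rule fm)
  obtain A B where A: "\<And>i. i \<in> {1..p} \<Longrightarrow> A i \<in> \<M>" and B: "\<And>i. i \<in> {1..q} \<Longrightarrow> B i \<in> \<N>"
    and nu: "nu p q V \<M> \<N> = (\<Sum>v\<in>V. min (occ v p A) (occ v q B))"
    by (rule nu_attained[OF assms(3-5), of p q]) blast
  define x where "x = (\<lambda>v. real (min (occ v p A) (occ v q B)))"
  have sum_x: "sum x S = real (\<Sum>v\<in>S. min (occ v p A) (occ v q B))" for S by (simp add: x_def)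
  have xM: "rank_feasible (real p) V \<M> x"
    unfolding M.rank_feasible_iff[OF of_nat_0_le_iff]
    unfolding sum_x of_nat_mult[symmetric] of_nat_le_iff
  proof (intro allI impI)
    fix S assume S: "S \<subseteq> V"
    have "(\<Sum>v\<in>S. min (occ v p A) (occ v q B)) \<le> (\<Sum>v\<in>S. occ v p A)" by (rule sum_mono) simp
    also have "\<dots> \<le> p * rank_in \<M> S" by (rule sum_occ_le[OF fm(1) S A])
    finally show "(\<Sum>v\<in>S. min (occ v p A) (occ v q B)) \<le> p * rank_in \<M> S" .
  qed
  have xN: "rank_feasible (real q) V \<N> x"
    unfolding N.rank_feasible_iff[OF of_nat_0_le_iff]
    unfolding sum_x of_nat_mult[symmetric] of_nat_le_iff
  proof (intro allI impI)
    fix S assume S: "S \<subseteq> V"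
    have "(\<Sum>v\<in>S. min (occ v p A) (occ v q B)) \<le> (\<Sum>v\<in>S. occ v q B)" by (rule sum_mono) simp
    also have "\<dots> \<le> q * rank_in \<N> S" by (rule sum_occ_le[OF fm(2) S B])
    finally show "(\<Sum>v\<in>S. min (occ v p A) (occ v q B)) \<le> q * rank_in \<N> S" .
  qed
  have common: "common_indep V \<M> V \<N> = \<M> \<inter> \<N>"
    using M.M_Pow by (auto simp: common_indep_def Int_absorb2)
  show ?thesis
  proof (rule eta_ge[OF assms(3)])
    show "\<M> \<inter> \<N> \<subseteq> Pow V" using M.M_Pow by blast
    show "{} \<in> \<M> \<inter> \<N>" using M.M_empty N.M_empty by simp
    fix k assume k: "real k < real (nu p q V \<M> \<N>) / real (p + q)"
    show "acyclic_at TYPE('r) (\<M> \<inter> \<N>) (int k - 1)"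
      unfolding common[symmetric]
    proof (rule acyclic_at_common_indep[OF _ _ _ _ xM xN])
      show "two_matroids V V \<M> \<N>" using fm by (simp add: two_matroids_iff)
      \<comment> \<open>The degree is d = k - 1, so d + 1 = k and the strict inequality on
        \<open>k\<close> is the hypothesis of the induction.\<close>
      have "real k * real (p + q) < real (nu p q V \<M> \<N>)"
        using k assms(1) by (simp add: pos_less_divide_eq)
      then show "real_of_int (int k - 1 + 1) * (real p + real q) < sum x (V \<union> V)"
        unfolding sum_x nu by simp
    qed (use assms(1,2) in \<open>auto simp: x_def\<close>)
  qed
qed

end
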